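(* Let $\mathcal{M}$ be a complete connected Riemannian manifold and let $f:\mathcal{M}\to\mathbb{R}$ be continuously differentiable. Assume that $\operatorname{grad} f$ is $L$-Lipschitz continuous on $\mathcal{M}$ ($L>0$), that there is $f_*\in\mathbb{R}$ with $f(x)\ge f_*$ for all $x\in\mathcal{M}$, and that $f$ satisfies the Riemannian Polyak--\L ojasiewicz inequality $$\lVert\operatorname{grad} f(x)\rVert^2\ge 2m\bigl(f(x)-f_*\bigr),\qquad x\in\mathcal{M},$$ for some $m>0$. Let $\{x_n\}$ (together with $\{w_n\},\{\alpha_n\}$) be generated by the RIAG-R algorithm with parameters $\eta>0$, $\varepsilon>0$, $\mu\in(0,1)$ and initial points $x_0,x_1\in\mathcal{M}$. Let $\alpha:=\inf_n\alpha_n(1-L\alpha_n/2)>0$, set $D:=\sum_{n=1}^\infty d(x_n,x_{n-1})^2<\infty$, and suppose $\alpha m<1$. Then, for all $n\ge1$, $$f(x_n)-f_*\;\le\;(1-\alpha m)^{n-1}\bigl(f(x_1)-f_*\bigr)+L\mu^2\Bigl(\alpha L+\tfrac12\Bigr)D .$$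
   Context: Notation: $\langle\cdot,\cdot\rangle$ and $\lVert\cdot\rVert$ are the Riemannian inner product and norm on the relevant tangent space, $d$ is the Riemannian distance, $\exp_x:T_x\mathcal{M}\to\mathcal{M}$ is the exponential map, and $\log_x(y)\in T_x\mathcal{M}$ denotes the logarithmic map, satisfying $\exp_x(\log_x(y))=y$ and $\lVert\log_x(y)\rVert=d(x,y)$. $\operatorname{grad} f$ is the Riemannian gradient. $L$-Lipschitz gradient: for any $x,y\in\mathcal{M}$ joined by a minimising geodesic $\gamma:[0,1]\to\mathcal{M}$ from $x$ to $y$, $\lVert \mathcal{P}_{\gamma,0,1}\operatorname{grad} f(x)-\operatorname{grad} f(y)\rVert\le L\,d(x,y)$, where $\mathcal{P}_{\gamma,0,1}:T_x\mathcal{M}\to T_y\mathcal{M}$ is parallel transport along $\gamma$. RIAG-R algorithm (parameters $\eta>0$, $\varepsilon>0$, $\mu\in(0,1)$; initial points $x_0,x_1\in\mathcal{M}$): set $G_0=0$, and for $n=1,2,3,\dots$: (1) $\bar\mu_n=\min\{\mu,\ \mu\, d(x_n,x_{n-1})\}$ if $x_n\ne x_{n-1}$, and $\bar\mu_n=\mu$ otherwise; (2) $d_n=-\log_{x_n}(x_{n-1})\in T_{x_n}\mathcal{M}$; (3) $\tilde\mu_n=0$ if $\langle\operatorname{grad} f(x_n),d_n\rangle>0$, and $\tilde\mu_n=\bar\mu_n$ otherwise; (4) $w_n=\exp_{x_n}(\tilde\mu_n d_n)$; (5) $G_n=G_{n-1}+\lVert\operatorname{grad} f(w_n)\rVert^2$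 and $\alpha_n=\eta/(\sqrt{G_n}+\varepsilon)$; (6) $x_{n+1}=\exp_{w_n}(-\alpha_n\operatorname{grad} f(w_n))$. The iteration is run indefinitely, producing infinite sequences. *)

theory Defs
  imports "HOL-Analysis.Analysis"
begin

text \<open>Differentiability of class \<open>C\<^sup>k\<close> on an open subset of a Euclidean space, by recursion over
  directional derivatives.\<close>

fun Ck_on :: "nat \<Rightarrow> ('e::euclidean_space \<Rightarrow> 'b::real_normed_vector) \<Rightarrow> 'e set \<Rightarrow> bool" where
  "Ck_on 0 f S \<longleftrightarrow> continuous_on S f"
| "Ck_on (Suc k) f S \<longleftrightarrow>
     f differentiable_on S \<and> (\<forall>v. Ck_on k (\<lambda>p. frechet_derivative f (at p) v) S)"

definition smooth_on :: "('e::euclidean_space \<Rightarrow> 'b::real_normed_vector) \<Rightarrow> 'e set \<Rightarrow> bool" where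
  "smooth_on f S \<longleftrightarrow> (\<forall>k. Ck_on k f S)"

text \<open>A chart is a pair of its domain and its coordinate map.\<close>

type_synonym ('a, 'e) chart = "'a set \<times> ('a \<Rightarrow> 'e)"

abbreviation chart_inv :: "('a, 'e) chart \<Rightarrow> 'e \<Rightarrow> 'a" where
  "chart_inv c \<equiv> inv_into (fst c) (snd c)"

definition smooth_atlas :: "('a::topological_space, 'e::euclidean_space) chart set \<Rightarrow> bool" where
  "smooth_atlas A \<longleftrightarrow>
     (\<Union>c\<in>A. fst c) = UNIV \<and>
     (\<forall>c\<in>A. open (fst c) \<and> open (snd c ` fst c) \<and>
        homeomorphism (fst c) (snd c ` fst c) (snd c) (chart_inv c)) \<and>
     (\<forall>c\<in>A. \<forall>c'\<in>A. smooth_on (snd c' \<circ> chart_inv c) (snd c ` (fst c \<inter> fst c')))"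

text \<open>A tangent vector at \<open>x\<close> is the family of its coordinate representations in all charts
  around \<open>x\<close>, related by the derivatives of the transition maps. The components in charts not
  containing \<open>x\<close> carry no information and are set to \<open>0\<close>.\<close>

type_synonym ('a, 'e) tangent = "('a, 'e) chart \<Rightarrow> 'e"

definition tangent_space ::
  "('a, 'e::euclidean_space) chart set \<Rightarrow> 'a \<Rightarrow> ('a, 'e) tangent set" where
  "tangent_space A x = {v.
     (\<forall>c. \<not> (c \<in> A \<and> x \<in> fst c) \<longrightarrow> v c = 0) \<and>
     (\<forall>c\<in>A. \<forall>c'\<in>A. x \<in> fst c \<and> x \<in> fst c' \<longrightarrow>
        v c' = frechet_derivative (snd c' \<circ> chart_inv c) (at (snd c x)) (v c))}"

definition tangent_of ::
  "('a, 'e::euclidean_space) chart set \<Rightarrow> ('a, 'e) chart \<Rightarrow> 'a \<Rightarrow> 'e \<Rightarrow> ('a, 'e) tangent" where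
  "tangent_of A c x u = (\<lambda>c'. if c' \<in> A \<and> x \<in> fst c'
     then frechet_derivative (snd c' \<circ> chart_inv c) (at (snd c x)) u else 0)"

definition tadd :: "('a, 'e::real_vector) tangent \<Rightarrow> ('a, 'e) tangent \<Rightarrow> ('a, 'e) tangent" where
  "tadd v w = (\<lambda>c. v c + w c)"

definition tscale :: "real \<Rightarrow> ('a, 'e::real_vector) tangent \<Rightarrow> ('a, 'e) tangent" where
  "tscale r v = (\<lambda>c. r *\<^sub>R v c)"

type_synonym ('a, 'e) metric = "'a \<Rightarrow> ('a, 'e) tangent \<Rightarrow> ('a, 'e) tangent \<Rightarrow> real"

definition metric_coord ::
  "('a, 'e::euclidean_space) chart set \<Rightarrow> ('a, 'e) metric \<Rightarrow> ('a, 'e) chart \<Rightarrow> 'e \<Rightarrow> 'e \<Rightarrow> 'e \<Rightarrow> real"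
  where
  "metric_coord A g c p u v =
     g (chart_inv c p) (tangent_of A c (chart_inv c p) u) (tangent_of A c (chart_inv c p) v)"

definition riemannian_metric ::
  "('a, 'e::euclidean_space) chart set \<Rightarrow> ('a, 'e) metric \<Rightarrow> bool" where
  "riemannian_metric A g \<longleftrightarrow>
     (\<forall>x. \<forall>u\<in>tangent_space A x. \<forall>v\<in>tangent_space A x. \<forall>w\<in>tangent_space A x. \<forall>r.
        g x u v = g x v u \<and>
        g x (tadd u v) w = g x u w + g x v w \<and>
        g x (tscale r u) v = r * g x u v \<and>
        (u \<noteq> (\<lambda>c. 0) \<longrightarrow> 0 < g x u u)) \<and>
     (\<forall>c\<in>A. \<forall>u v. smooth_on (\<lambda>p. metric_coord A g c p u v) (snd c ` fst c))"

definition riemannian_manifold ::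
  "('a::{t2_space, second_countable_topology}, 'e::euclidean_space) chart set
     \<Rightarrow> ('a, 'e) metric \<Rightarrow> bool" where
  "riemannian_manifold A g \<longleftrightarrow> smooth_atlas A \<and> riemannian_metric A g"

definition tnorm :: "('a, 'e) metric \<Rightarrow> 'a \<Rightarrow> ('a, 'e) tangent \<Rightarrow> real" where
  "tnorm g x v = sqrt (g x v v)"

text \<open>On a compact interval \<open>I\<close> the velocity at the end points is one-sided.\<close>

definition velocity ::
  "('a, 'e::euclidean_space) chart set \<Rightarrow> real set \<Rightarrow> (real \<Rightarrow> 'a) \<Rightarrow> real \<Rightarrow> ('a, 'e) tangent" where
  "velocity A I \<gamma> t = (\<lambda>c. if c \<in> A \<and> \<gamma> t \<in> fst c
     then vector_derivative (snd c \<circ> \<gamma>) (at t within I) else 0)"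

definition C1_curve ::
  "('a::topological_space, 'e::euclidean_space) chart set \<Rightarrow> real set \<Rightarrow> (real \<Rightarrow> 'a) \<Rightarrow> bool" where
  "C1_curve A I \<gamma> \<longleftrightarrow> continuous_on I \<gamma> \<and>
     (\<forall>c\<in>A. \<forall>t\<in>I. \<gamma> t \<in> fst c \<longrightarrow>
        (snd c \<circ> \<gamma>) differentiable (at t within I) \<and>
        continuous (at t within I) (\<lambda>s. velocity A I \<gamma> s c))"

definition piecewise_C1_curve ::
  "('a::topological_space, 'e::euclidean_space) chart set \<Rightarrow> (real \<Rightarrow> 'a) \<Rightarrow> bool" where
  "piecewise_C1_curve A \<gamma> \<longleftrightarrow> continuous_on {0..1} \<gamma> \<and>
     (\<exists>S. finite S \<and>
        (\<forall>a b. 0 \<le> a \<and> a < b \<and> b \<le> 1 \<and> S \<inter> {a<..<b} = {} \<longrightarrow> C1_curve A {a..b} \<gamma>))"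

definition curve_length ::
  "('a, 'e::euclidean_space) chart set \<Rightarrow> ('a, 'e) metric \<Rightarrow> (real \<Rightarrow> 'a) \<Rightarrow> real" where
  "curve_length A g \<gamma> = integral {0..1} (\<lambda>t. tnorm g (\<gamma> t) (velocity A {0..1} \<gamma> t))"

definition rdist ::
  "('a::topological_space, 'e::euclidean_space) chart set \<Rightarrow> ('a, 'e) metric \<Rightarrow> 'a \<Rightarrow> 'a \<Rightarrow> real" where
  "rdist A g x y =
     Inf {curve_length A g \<gamma> | \<gamma>. piecewise_C1_curve A \<gamma> \<and> \<gamma> 0 = x \<and> \<gamma> 1 = y}"

text \<open>The Christoffel map \<open>\<Gamma>\<^sub>p(u, v)\<close> of the Levi-Civita connection in a chart, given by the
  Koszul formula for the constant coordinate fields \<open>u, v, w\<close>.\<close>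

definition christoffel ::
  "('a, 'e::euclidean_space) chart set \<Rightarrow> ('a, 'e) metric \<Rightarrow> ('a, 'e) chart \<Rightarrow> 'e \<Rightarrow> 'e \<Rightarrow> 'e \<Rightarrow> 'e"
  where
  "christoffel A g c p u v = (THE z. \<forall>w.
     metric_coord A g c p z w =
       (frechet_derivative (\<lambda>q. metric_coord A g c q v w) (at p) u +
        frechet_derivative (\<lambda>q. metric_coord A g c q u w) (at p) v -
        frechet_derivative (\<lambda>q. metric_coord A g c q u v) (at p) w) / 2)"

text \<open>\<open>V\<close> is a parallel vector field along the curve \<open>\<gamma>\<close>: its covariant derivative
  \<open>V' + \<Gamma>(\<gamma>', V)\<close> vanishes in every chart.\<close>

definition parallel_along ::
  "('a::topological_space, 'e::euclidean_space) chart set \<Rightarrow> ('a, 'e) metric \<Rightarrow> real set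
     \<Rightarrow> (real \<Rightarrow> 'a) \<Rightarrow> (real \<Rightarrow> ('a, 'e) tangent) \<Rightarrow> bool" where
  "parallel_along A g I \<gamma> V \<longleftrightarrow>
     (\<forall>t\<in>I. V t \<in> tangent_space A (\<gamma> t) \<and>
        (\<forall>c\<in>A. \<gamma> t \<in> fst c \<longrightarrow>
           ((\<lambda>s. V s c) has_vector_derivative
              - christoffel A g c (snd c (\<gamma> t)) (velocity A I \<gamma> t c) (V t c)) (at t within I)))"

definition geodesic ::
  "('a::topological_space, 'e::euclidean_space) chart set \<Rightarrow> ('a, 'e) metric \<Rightarrow> real set
     \<Rightarrow> (real \<Rightarrow> 'a) \<Rightarrow> bool" where
  "geodesic A g I \<gamma> \<longleftrightarrow> C1_curve A I \<gamma> \<and> parallel_along A g I \<gamma> (velocity A I \<gamma>)"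

definition minimising_geodesic ::
  "('a::topological_space, 'e::euclidean_space) chart set \<Rightarrow> ('a, 'e) metric \<Rightarrow> 'a \<Rightarrow> 'a
     \<Rightarrow> (real \<Rightarrow> 'a) \<Rightarrow> bool" where
  "minimising_geodesic A g x y \<gamma> \<longleftrightarrow>
     geodesic A g {0..1} \<gamma> \<and> \<gamma> 0 = x \<and> \<gamma> 1 = y \<and> curve_length A g \<gamma> = rdist A g x y"

definition geodesically_complete ::
  "('a::topological_space, 'e::euclidean_space) chart set \<Rightarrow> ('a, 'e) metric \<Rightarrow> bool" where
  "geodesically_complete A g \<longleftrightarrow>
     (\<forall>x. \<forall>v\<in>tangent_space A x.
        \<exists>\<gamma>. geodesic A g UNIV \<gamma> \<and> \<gamma> 0 = x \<and> velocity A UNIV \<gamma> 0 = v)"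

text \<open>In the next two definitions the choice operator selects a unique object (the solution of an
  ordinary differential equation), so no actual choice is involved.\<close>

definition exp_map ::
  "('a::topological_space, 'e::euclidean_space) chart set \<Rightarrow> ('a, 'e) metric \<Rightarrow> 'a
     \<Rightarrow> ('a, 'e) tangent \<Rightarrow> 'a" where
  "exp_map A g x v =
     (SOME \<gamma>. geodesic A g UNIV \<gamma> \<and> \<gamma> 0 = x \<and> velocity A UNIV \<gamma> 0 = v) 1"

definition parallel_transport ::
  "('a::topological_space, 'e::euclidean_space) chart set \<Rightarrow> ('a, 'e) metric \<Rightarrow> (real \<Rightarrow> 'a)
     \<Rightarrow> ('a, 'e) tangent \<Rightarrow> ('a, 'e) tangent" where
  "parallel_transport A g \<gamma> v =
     (SOME w. \<exists>V. parallel_along A g {0..1} \<gamma> V \<and> V 0 = v \<and> V 1 = w)"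

text \<open>A logarithmic map picks an initial velocity of some minimising geodesic; on the cut locus
  several choices are possible.\<close>

definition logarithmic_map ::
  "('a::topological_space, 'e::euclidean_space) chart set \<Rightarrow> ('a, 'e) metric
     \<Rightarrow> ('a \<Rightarrow> 'a \<Rightarrow> ('a, 'e) tangent) \<Rightarrow> bool" where
  "logarithmic_map A g lg \<longleftrightarrow>
     (\<forall>x y. lg x y \<in> tangent_space A x \<and> exp_map A g x (lg x y) = y \<and>
        tnorm g x (lg x y) = rdist A g x y)"

definition C1_function ::
  "('a, 'e::euclidean_space) chart set \<Rightarrow> ('a \<Rightarrow> real) \<Rightarrow> bool" where
  "C1_function A f \<longleftrightarrow> (\<forall>c\<in>A. Ck_on 1 (f \<circ> chart_inv c) (snd c ` fst c))"

definition grad ::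
  "('a, 'e::euclidean_space) chart set \<Rightarrow> ('a, 'e) metric \<Rightarrow> ('a \<Rightarrow> real) \<Rightarrow> 'a \<Rightarrow> ('a, 'e) tangent"
  where
  "grad A g f x = (THE v. v \<in> tangent_space A x \<and>
     (\<forall>u\<in>tangent_space A x. \<forall>c\<in>A. x \<in> fst c \<longrightarrow>
        g x v u = frechet_derivative (f \<circ> chart_inv c) (at (snd c x)) (u c)))"

definition lipschitz_gradient ::
  "('a::topological_space, 'e::euclidean_space) chart set \<Rightarrow> ('a, 'e) metric \<Rightarrow> ('a \<Rightarrow> real)
     \<Rightarrow> real \<Rightarrow> bool" where
  "lipschitz_gradient A g f L \<longleftrightarrow>
     (\<forall>x y \<gamma>. minimising_geodesic A g x y \<gamma> \<longrightarrow>
        tnorm g y (tadd (parallel_transport A g \<gamma> (grad A g f x)) (tscale (-1) (grad A g f y)))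
          \<le> L * rdist A g x y)"

text \<open>The sequences \<open>w\<close> and \<open>\<alpha>\<close> are indexed from \<open>1\<close>; their values at \<open>0\<close> are irrelevant.
  The initial points are \<open>x 0\<close> and \<open>x 1\<close>.\<close>

definition riag_r ::
  "('a::topological_space, 'e::euclidean_space) chart set \<Rightarrow> ('a, 'e) metric
     \<Rightarrow> ('a \<Rightarrow> 'a \<Rightarrow> ('a, 'e) tangent) \<Rightarrow> ('a \<Rightarrow> real) \<Rightarrow> real \<Rightarrow> real \<Rightarrow> real
     \<Rightarrow> (nat \<Rightarrow> 'a) \<Rightarrow> (nat \<Rightarrow> 'a) \<Rightarrow> (nat \<Rightarrow> real) \<Rightarrow> (nat \<Rightarrow> real) \<Rightarrow> bool" where
  "riag_r A g lg f \<eta> \<epsilon> \<mu> x w G \<alpha> \<longleftrightarrow>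
     G 0 = 0 \<and>
     (\<forall>n\<ge>1.
        let \<mu>_bar = (if x n \<noteq> x (n - 1) then min \<mu> (\<mu> * rdist A g (x n) (x (n - 1))) else \<mu>);
            d = tscale (-1) (lg (x n) (x (n - 1)));
            \<mu>_tilde = (if g (x n) (grad A g f (x n)) d > 0 then 0 else \<mu>_bar)
        in w n = exp_map A g (x n) (tscale \<mu>_tilde d) \<and>
           G n = G (n - 1) + (tnorm g (w n) (grad A g f (w n)))\<^sup>2 \<and>
           \<alpha> n = \<eta> / (sqrt (G n) + \<epsilon>) \<and>
           x (n + 1) = exp_map A g (w n) (tscale (- \<alpha> n) (grad A g f (w n))))"

end

theory Submission
  imports Defs
begin

text \<open>The heart of the matter is a descent inequality along arbitrary geodesics,
  \<open>f (exp\<^sub>x v) \<le> f x + \<langle>grad f x, v\<rangle> + L/2 \<parallel>v\<parallel>\<^sup>2\<close> (lemma \<open>descent\<close>). Granted this, one round of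
  the iteration is elementary. In the extrapolation step the linear term is nonpositive, because
  the step is switched off when \<open>\<langle>grad f x\<^sub>n, d\<^sub>n\<rangle> > 0\<close>, so \<open>f w\<^sub>n\<close> exceeds \<open>f x\<^sub>n\<close> by at most
  \<open>L \<mu>\<^sup>2/2 d(x\<^sub>n, x\<^sub>n\<^sub>-\<^sub>1)\<^sup>2\<close>; the gradient step decreases \<open>f\<close> by at least \<open>\<alpha> \<parallel>grad f w\<^sub>n\<parallel>\<^sup>2\<close>, and
  the Polyak-Lojasiewicz inequality turns this into a contraction of \<open>f - f\<^sub>*\<close> by \<open>1 - \<alpha> m\<close>.
  Summing the errors gives the constant \<open>L \<mu>\<^sup>2/2 D\<close>, which is at most the claimed one.

  The Lipschitz hypothesis speaks of minimising geodesics only, whereas the gradient step follows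
  a geodesic \<open>\<gamma>\<close> that need not minimise. The two are compared infinitesimally. Fix \<open>p = \<gamma> t\<close>; for
  \<open>s\<close> near \<open>t\<close> let \<open>\<sigma>\<^sub>s\<close> be a minimising geodesic from \<open>p\<close> to \<open>\<gamma> s\<close>, which a logarithmic map
  provides. Whatever \<open>\<sigma>\<^sub>s\<close> is, its length is at most \<open>\<bar>s - t\<bar> \<parallel>\<gamma>'\<parallel>\<close>, so in a chart around \<open>p\<close>
  transport along it equals, up to \<open>o(\<bar>s - t\<bar>)\<close>, the linear map \<open>W \<mapsto> W - \<Gamma>\<^sub>p(\<gamma> s - p, W)\<close> (lemma
  \<open>infinitesimal_transport\<close>). By metric compatibility of the Christoffel map, the product of the
  transported gradient with \<open>\<gamma>' s\<close> therefore has derivative \<open>0\<close> at \<open>t\<close> (lemma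
  \<open>transported_product_stationary\<close>). Together with the Lipschitz hypothesis for \<open>\<sigma>\<^sub>s\<close> this bounds
  the local variation of the slope \<open>(f \<circ> \<gamma>)'\<close> by \<open>L \<parallel>\<gamma>'\<parallel>\<^sup>2\<close> per unit of time; such a local bound
  globalises by bisection, and integrating it gives the descent inequality.

  Parallel transport is only meaningful once parallel fields exist. Along a short geodesic they
  solve a linear differential equation in a single chart, for which the Picard operator is already
  a contraction; that the solution is parallel in every other chart as well is the transformation
  law of the Christoffel map (lemma \<open>christoffel_transition\<close>). This law follows from completeness
  with little computation: the geodesic equation holds in both charts for every initial velocity,
  which determines the law on the diagonal, and the two sides are symmetric bilinear forms.\<close>

section \<open>Derivatives, bilinear families and linear differential equations\<close>

lemma frechet_derivative_eqI_open:
  assumes "open U" "q \<in> U" "\<And>q. q \<in> U \<Longrightarrow> f q = h q" "(h has_derivative h') (at q)"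
  shows "frechet_derivative f (at q) = h'"
proof -
  have "(f has_derivative h') (at q)"
    by (rule has_derivative_transform_within_open[OF assms(4,1,2)]) (simp add: assms(3))
  then show ?thesis using frechet_derivative_at by metis
qed

lemma vector_derivative_bound:
  fixes f :: "real \<Rightarrow> 'b::real_normed_vector"
  assumes "\<And>r. r \<in> {a..b} \<Longrightarrow> (f has_vector_derivative f' r) (at r within {a..b})"
    and B: "\<And>r. r \<in> {a..b} \<Longrightarrow> norm (f' r) \<le> B" and "a \<le> b"
  shows "norm (f b - f a) \<le> B * (b - a)"
proof -
  have "norm (f b - f a) \<le> B * norm (b - a)"
  proof (rule differentiable_bound[of "{a..b}" f "\<lambda>r h. h *\<^sub>R f' r"])
    show "onorm (\<lambda>h. h *\<^sub>R f' r) \<le> B" if "r \<in> {a..b}" for r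
      using B[OF that] by (intro onorm_le) (simp add: mult.commute[of B] mult_left_mono)
  qed (use assms in \<open>auto simp: has_vector_derivative_def\<close>)
  then show ?thesis using \<open>a \<le> b\<close> by simp
qed

text \<open>The second difference of \<open>\<phi>\<close> over the parallelogram spanned by \<open>h a\<close> and \<open>h b\<close> is symmetric
  in \<open>a\<close> and \<open>b\<close>; by the mean value theorem applied in direction \<open>a\<close> it equals \<open>h\<^sup>2 A b + o(h\<^sup>2)\<close>.\<close>

lemma second_derivative_symmetric:
  fixes \<phi> :: "'a::real_normed_vector \<Rightarrow> 'b::real_normed_vector"
  assumes "open U" "p \<in> U"
    and D: "\<And>q. q \<in> U \<Longrightarrow> (\<phi> has_derivative \<phi>' q) (at q)"
    and A: "((\<lambda>q. \<phi>' q a) has_derivative A) (at p)"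
    and B: "((\<lambda>q. \<phi>' q b) has_derivative B) (at p)"
  shows "A b = B a"
proof -
  define \<Delta> where "\<Delta> h = \<phi> (p + h *\<^sub>R a + h *\<^sub>R b) - \<phi> (p + h *\<^sub>R a) - \<phi> (p + h *\<^sub>R b) + \<phi> p" for h
  \<comment> \<open>Stated for arbitrary \<open>a\<close>, \<open>b\<close> and \<open>A\<close>, so that it applies to both orders of differentiation.\<close>
  have key: "\<exists>d>0. \<forall>h. 0 < h \<and> h < d \<longrightarrow>
      norm (\<phi> (p + h *\<^sub>R a + h *\<^sub>R b) - \<phi> (p + h *\<^sub>R a) - \<phi> (p + h *\<^sub>R b) + \<phi> p - (h * h) *\<^sub>R A b)
        \<le> e * (h * h)"
    if A: "((\<lambda>q. \<phi>' q a) has_derivative A) (at p)" and "e > 0" for a b A and e :: real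
  proof -
    interpret A: bounded_linear A using A by (rule has_derivative_bounded_linear)
    define C where "C = norm a + norm b + 1"
    have C: "C > 0" "norm a + norm b < C" unfolding C_def by (simp_all add: add_nonneg_pos)
    define e' where "e' = e / (2 * C)"
    have e': "e' > 0" using \<open>e > 0\<close> C by (simp add: e'_def)
    obtain r where r: "r > 0" "ball p r \<subseteq> U"
      using assms(1,2) open_contains_ball by blast
    obtain d0 where d0: "d0 > 0"
      "\<And>q. norm (q - p) < d0 \<Longrightarrow> norm (\<phi>' q a - \<phi>' p a - A (q - p)) \<le> e' * norm (q - p)"
      using A e' unfolding has_derivative_at_alt by blast
    define d where "d = min r d0 / C"
    have d: "d > 0" using r d0 C by (simp add: d_def)
    show ?thesis
    proof (intro exI[of _ d] conjI d allI impI)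
      fix h assume h: "0 < h \<and> h < d"
      have small: "norm (s *\<^sub>R a + k *\<^sub>R b) < min r d0 \<and> norm (s *\<^sub>R a + k *\<^sub>R b) \<le> h * C"
        if "0 \<le> s" "s \<le> h" "0 \<le> k" "k \<le> h" for s k
      proof -
        have "norm (s *\<^sub>R a + k *\<^sub>R b) \<le> s * norm a + k * norm b"
          using that norm_triangle_ineq[of "s *\<^sub>R a" "k *\<^sub>R b"] by simp
        also have "\<dots> \<le> h * norm a + h * norm b"
          using that by (intro add_mono mult_right_mono) auto
        also have "\<dots> \<le> h * C" using C h by (simp add: flip: distrib_left)
        finally have 1: "norm (s *\<^sub>R a + k *\<^sub>R b) \<le> h * C" .
        also have "h * C < min r d0" using h C by (simp add: d_def field_simps)
        finally show ?thesis using 1 by simp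
      qed
      have inU: "p + s *\<^sub>R a + k *\<^sub>R b \<in> U" if "0 \<le> s" "s \<le> h" "0 \<le> k" "k \<le> h" for s k
      proof -
        have "p + s *\<^sub>R a + k *\<^sub>R b \<in> ball p r"
          using small[OF that] norm_minus_cancel[of "s *\<^sub>R a + k *\<^sub>R b"]
          by (simp only: mem_ball dist_norm) (simp add: add.assoc)
        then show ?thesis using r by blast
      qed
      define F where "F s = \<phi> (p + s *\<^sub>R a + h *\<^sub>R b) - \<phi> (p + s *\<^sub>R a) - (s * h) *\<^sub>R A b" for s
      have F': "(F has_derivative (\<lambda>x. x *\<^sub>R (\<phi>' (p + s *\<^sub>R a + h *\<^sub>R b) a - \<phi>' (p + s *\<^sub>R a) a - h *\<^sub>R A b)))
           (at s within {0..h})" if s: "s \<in> {0..h}" for s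
      proof -
        have 1: "(\<phi> has_derivative \<phi>' (p + s *\<^sub>R a + h *\<^sub>R b)) (at (p + s *\<^sub>R a + h *\<^sub>R b))"
          using D inU[of s h] s h by auto
        have 2: "(\<phi> has_derivative \<phi>' (p + s *\<^sub>R a)) (at (p + s *\<^sub>R a))"
          using D inU[of s 0] s h by auto
        have l1: "\<phi>' (p + s *\<^sub>R a + h *\<^sub>R b) (x *\<^sub>R a) = x *\<^sub>R \<phi>' (p + s *\<^sub>R a + h *\<^sub>R b) a" for x
          using has_derivative_linear[OF 1] by (rule linear_scale)
        have l2: "\<phi>' (p + s *\<^sub>R a) (x *\<^sub>R a) = x *\<^sub>R \<phi>' (p + s *\<^sub>R a) a" for x
          using has_derivative_linear[OF 2] by (rule linear_scale)
        have i1: "((\<lambda>s. p + s *\<^sub>R a + h *\<^sub>R b) has_derivative (\<lambda>x. x *\<^sub>R a)) (at s within {0..h})"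
          by (auto intro!: derivative_eq_intros)
        have i2: "((\<lambda>s. p + s *\<^sub>R a) has_derivative (\<lambda>x. x *\<^sub>R a)) (at s within {0..h})"
          by (auto intro!: derivative_eq_intros)
        show ?thesis unfolding F_def
          using has_derivative_compose[OF i1 1] has_derivative_compose[OF i2 2]
          by (auto intro!: derivative_eq_intros simp: l1 l2 scaleR_diff_right)
      qed
      have bd: "norm (\<phi>' (p + s *\<^sub>R a + h *\<^sub>R b) a - \<phi>' (p + s *\<^sub>R a) a - h *\<^sub>R A b) \<le> e * h"
        if s: "s \<in> {0..h}" for s
      proof -
        let ?q = "p + s *\<^sub>R a + h *\<^sub>R b" and ?q' = "p + s *\<^sub>R a"
        have 1: "norm (\<phi>' ?q a - \<phi>' p a - A (?q - p)) \<le> e' * (h * C)"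
          using d0(2)[of ?q] small[of s h] s h e'
          by (smt (verit, best) add.assoc add_diff_cancel_left' atLeastAtMost_iff mult_left_mono)
        have 2: "norm (\<phi>' ?q' a - \<phi>' p a - A (?q' - p)) \<le> e' * (h * C)"
          using d0(2)[of ?q'] small[of s 0] s h e'
          by (smt (verit, best) add.right_neutral scaleR_zero_left add_diff_cancel_left' atLeastAtMost_iff mult_left_mono)
        have "\<phi>' ?q a - \<phi>' ?q' a - h *\<^sub>R A b
            = (\<phi>' ?q a - \<phi>' p a - A (?q - p)) - (\<phi>' ?q' a - \<phi>' p a - A (?q' - p))"
          by (simp add: A.add A.scaleR A.diff add.assoc)
        then have "norm (\<phi>' ?q a - \<phi>' ?q' a - h *\<^sub>R A b) \<le> e' * (h * C) + e' * (h * C)"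
          using 1 2 by (metis (no_types, lifting) add_mono norm_triangle_le_diff)
        also have "\<dots> = e * h" using C by (simp add: e'_def)
        finally show ?thesis .
      qed
      have "norm (F h - F 0) \<le> e * h * norm (h - 0)"
      proof (rule differentiable_bound[OF _ F'])
        fix s assume s: "s \<in> {0..h}"
        show "onorm (\<lambda>x. x *\<^sub>R (\<phi>' (p + s *\<^sub>R a + h *\<^sub>R b) a - \<phi>' (p + s *\<^sub>R a) a - h *\<^sub>R A b)) \<le> e * h"
          using bd[OF s] by (intro onorm_le) (simp add: mult.commute mult_left_mono)
      qed (use h in auto)
      moreover have "F h - F 0 = \<phi> (p + h *\<^sub>R a + h *\<^sub>R b) - \<phi> (p + h *\<^sub>R a) - \<phi> (p + h *\<^sub>R b) + \<phi> p - (h * h) *\<^sub>R A b"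
        by (simp add: F_def)
      ultimately show "norm (\<phi> (p + h *\<^sub>R a + h *\<^sub>R b) - \<phi> (p + h *\<^sub>R a) - \<phi> (p + h *\<^sub>R b) + \<phi> p - (h * h) *\<^sub>R A b)
        \<le> e * (h * h)" using h by simp
    qed
  qed
  have "norm (A b - B a) \<le> e" if "e > 0" for e
  proof -
    obtain d1 where d1: "d1 > 0" "\<And>h. 0 < h \<and> h < d1 \<Longrightarrow> norm (\<Delta> h - (h * h) *\<^sub>R A b) \<le> (e/2) * (h * h)"
      using key[OF A, of "e/2" b] \<open>e > 0\<close> unfolding \<Delta>_def by auto
    obtain d2 where d2: "d2 > 0" "\<And>h. 0 < h \<and> h < d2 \<Longrightarrow> norm (\<Delta> h - (h * h) *\<^sub>R B a) \<le> (e/2) * (h * h)"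
      using key[OF B, of "e/2" a] \<open>e > 0\<close> unfolding \<Delta>_def by (auto simp: algebra_simps)
    define h where "h = min d1 d2 / 2"
    have h: "0 < h" "h < d1" "h < d2" using d1(1) d2(1) by (auto simp: h_def min_def)
    have "norm ((h * h) *\<^sub>R (A b - B a)) = norm ((\<Delta> h - (h * h) *\<^sub>R B a) - (\<Delta> h - (h * h) *\<^sub>R A b))"
      by (simp add: algebra_simps)
    also have "\<dots> \<le> (e/2) * (h * h) + (e/2) * (h * h)"
      using d1(2)[of h] d2(2)[of h] h by (meson add_mono norm_triangle_le_diff)
    finally show ?thesis using h by (simp add: mult.commute)
  qed
  then have "norm (A b - B a) \<le> 0" by (rule field_le_epsilon[where y=0, simplified])
  then show ?thesis by simp
qed

text \<open>A family of linear maps on a Euclidean space is a finite combination of its values on the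
  basis, so regularity in the parameter for each fixed vector is enough for joint regularity.\<close>

lemma linear_family_continuous_on:
  fixes F :: "'p::topological_space \<Rightarrow> 'e::euclidean_space \<Rightarrow> 'h::real_normed_vector"
  assumes lin: "\<And>q. q \<in> U \<Longrightarrow> linear (F q)"
    and cont: "\<And>u. continuous_on U (\<lambda>q. F q u)"
    and X: "continuous_on S X" "X ` S \<subseteq> U" and v: "continuous_on S v"
  shows "continuous_on S (\<lambda>s. F (X s) (v s))"
proof -
  have "continuous_on S (\<lambda>s. \<Sum>i\<in>Basis. (v s \<bullet> i) *\<^sub>R F (X s) i)"
    using X v by (intro continuous_intros continuous_on_compose2[OF cont])
  moreover have "(\<Sum>i\<in>Basis. (v s \<bullet> i) *\<^sub>R F (X s) i) = F (X s) (v s)" if "s \<in> S" for s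
    using X that lin[of "X s"] linear_sum[of "F (X s)" "\<lambda>i. (v s \<bullet> i) *\<^sub>R i" Basis]
    by (auto simp: linear_scale euclidean_representation)
  ultimately show ?thesis by (simp cong: continuous_on_cong)
qed

lemma linear_family_has_derivative:
  fixes F :: "'p::real_normed_vector \<Rightarrow> 'e::euclidean_space \<Rightarrow> 'h::real_normed_vector"
  assumes lin: "\<And>q. q \<in> U \<Longrightarrow> linear (F q)" and U: "open U" "X t \<in> U"
    and F': "\<And>u. ((\<lambda>q. F q u) has_derivative F' u) (at (X t))"
    and X': "(X has_derivative X') (at t within S)"
    and v': "(v has_derivative v') (at t within S)" and t: "t \<in> S"
  shows "((\<lambda>s. F (X s) (v s)) has_derivative (\<lambda>h. F' (v t) (X' h) + F (X t) (v' h))) (at t within S)"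
proof -
  have rep: "F q u = (\<Sum>i\<in>Basis. (u \<bullet> i) *\<^sub>R F q i)" if "q \<in> U" for q u
    using lin[OF that] linear_sum[of "F q" "\<lambda>i. (u \<bullet> i) *\<^sub>R i" Basis]
    by (auto simp: linear_scale euclidean_representation)
  have "F' u = (\<lambda>h. \<Sum>i\<in>Basis. (u \<bullet> i) *\<^sub>R F' i h)" for u
  proof (rule has_derivative_unique[OF F'])
    have "((\<lambda>q. \<Sum>i\<in>Basis. (u \<bullet> i) *\<^sub>R F q i) has_derivative (\<lambda>h. \<Sum>i\<in>Basis. (u \<bullet> i) *\<^sub>R F' i h)) (at (X t))"
      by (auto intro!: derivative_eq_intros F')
    then show "((\<lambda>q. F q u) has_derivative (\<lambda>h. \<Sum>i\<in>Basis. (u \<bullet> i) *\<^sub>R F' i h)) (at (X t))"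
      by (rule has_derivative_transform_within_open[OF _ U]) (simp add: rep)
  qed
  then have "F' (v t) (X' h) = (\<Sum>i\<in>Basis. (v t \<bullet> i) *\<^sub>R F' i (X' h))" for h
    by metis
  then have eq: "F' (v t) (X' h) + F (X t) (v' h)
      = (\<Sum>i\<in>Basis. (v t \<bullet> i) *\<^sub>R F' i (X' h) + (v' h \<bullet> i) *\<^sub>R F (X t) i)" for h
    using rep[OF U(2), of "v' h"] by (simp only: sum.distrib)
  have ev: "\<forall>\<^sub>F s in at t within S. (\<Sum>i\<in>Basis. (v s \<bullet> i) *\<^sub>R F (X s) i) = F (X s) (v s)"
  proof -
    have "\<forall>\<^sub>F s in at t within S. X s \<in> U"
      using has_derivative_continuous[OF X'] U topological_tendstoD
      unfolding continuous_within by blast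
    then show ?thesis by (rule eventually_mono) (rule rep[symmetric])
  qed
  have "((\<lambda>s. \<Sum>i\<in>Basis. (v s \<bullet> i) *\<^sub>R F (X s) i) has_derivative
      (\<lambda>h. F' (v t) (X' h) + F (X t) (v' h))) (at t within S)"
    unfolding eq
    by (rule has_derivative_sum)
      (auto intro!: derivative_eq_intros has_derivative_compose[OF X' F'] v')
  then show ?thesis
    by (rule has_derivative_transform_eventually[OF _ ev]) (use rep[OF U(2), symmetric] t in auto)
qed

text \<open>Two applications of the linear case: the family is first regarded as linear in its last
  argument with the pair of the parameter and the first vector as parameter.\<close>

lemma bilinear_family_has_derivative:
  fixes G :: "'p::real_normed_vector \<Rightarrow> 'e::euclidean_space \<Rightarrow> 'd::euclidean_space \<Rightarrow> 'h::real_normed_vector"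
  assumes lin: "\<And>q. q \<in> U \<Longrightarrow> bilinear (G q)" and U: "open U" "X t \<in> U"
    and G': "\<And>u v. ((\<lambda>q. G q u v) has_derivative G' u v) (at (X t))"
    and X': "(X has_derivative X') (at t within S)"
    and u': "(u has_derivative u') (at t within S)"
    and v': "(v has_derivative v') (at t within S)" and t: "t \<in> S"
  shows "((\<lambda>s. G (X s) (u s) (v s)) has_derivative
     (\<lambda>h. G' (u t) (v t) (X' h) + G (X t) (u' h) (v t) + G (X t) (u t) (v' h))) (at t within S)"
proof -
  have "((\<lambda>s. (\<lambda>z. G (fst z) (snd z)) (X s, u s) (v s)) has_derivative
      (\<lambda>h. (\<lambda>v z. G' (u t) v (fst z) + G (X t) (snd z) v) (v t) (X' h, u' h) + 
        (\<lambda>z. G (fst z) (snd z)) (X t, u t) (v' h))) (at t within S)"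
  proof (rule linear_family_has_derivative[where U="U \<times> UNIV" and X="\<lambda>s. (X s, u s)"])
    show "linear (\<lambda>v. G (fst q) (snd q) v)" if "q \<in> U \<times> UNIV" for q
      using lin[of "fst q"] that unfolding bilinear_def by auto
    show "((\<lambda>q. G (fst q) (snd q) w) has_derivative (\<lambda>z. G' (u t) w (fst z) + G (X t) (snd z) w)) (at (X t, u t))" for w
    proof -
      have "((\<lambda>z. (\<lambda>q u. G q u w) (fst z) (snd z)) has_derivative
        (\<lambda>h. (\<lambda>u. G' u w) (snd (X t, u t)) (fst h) + (\<lambda>q u. G q u w) (fst (X t, u t)) (snd h))) (at (X t, u t))"
        by (rule linear_family_has_derivative[where U=U])
          (use lin U G' in \<open>auto simp: bilinear_def intro!: derivative_eq_intros\<close>)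
      then show ?thesis by simp
    qed
  qed (use U X' u' v' t in \<open>auto intro!: open_Times has_derivative_Pair\<close>)
  then show ?thesis by simp
qed

text \<open>Pointwise continuity on the finitely many pairs of basis vectors gives closeness in the
  operator norm.\<close>

lemma bilinear_family_close:
  fixes B :: "'p::t2_space \<Rightarrow> 'e::euclidean_space \<Rightarrow> 'd::euclidean_space \<Rightarrow> 'h::real_normed_vector"
  assumes bil: "\<And>q. q \<in> U \<Longrightarrow> bilinear (B q)" and U: "open U" "p \<in> U"
    and cont: "\<And>u v. continuous_on U (\<lambda>q. B q u v)" and e: "e > 0"
  shows "\<forall>\<^sub>F q in nhds p. q \<in> U \<and> (\<forall>u v. norm (B q u v - B p u v) \<le> e * norm u * norm v)"
proof -
  define n where "n = real (DIM('e) * DIM('d))"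
  have n: "n > 0" by (simp add: n_def)
  have ev: "\<forall>\<^sub>F q in nhds p. q \<in> U \<and> (\<forall>i\<in>Basis. \<forall>j\<in>Basis. dist (B q i j) (B p i j) < e / n)"
  proof (intro eventually_conj eventually_ball_finite ballI)
    show "\<forall>\<^sub>F q in nhds p. q \<in> U" using U by (rule eventually_nhds_in_open)
    fix i :: 'e and j :: 'd
    have "isCont (\<lambda>q. B q i j) p" using cont U continuous_on_eq_continuous_at by blast
    then have "((\<lambda>q. B q i j) \<longlongrightarrow> B p i j) (nhds p)"
      unfolding isCont_def by (rule tendsto_at_iff_tendsto_nhds[of "\<lambda>q. B q i j" p, THEN iffD1])
    then show "\<forall>\<^sub>F q in nhds p. dist (B q i j) (B p i j) < e / n"
      using e n by (intro tendstoD) auto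
  qed auto
  have exp: "B q u v = (\<Sum>i\<in>Basis. \<Sum>j\<in>Basis. ((u \<bullet> i) * (v \<bullet> j)) *\<^sub>R B q i j)" if "q \<in> U" for q u v
  proof -
    have "B q u v = B q (\<Sum>i\<in>Basis. (u \<bullet> i) *\<^sub>R i) (\<Sum>j\<in>Basis. (v \<bullet> j) *\<^sub>R j)"
      by (simp add: euclidean_representation)
    also have "\<dots> = (\<Sum>(i,j)\<in>Basis \<times> Basis. B q ((u \<bullet> i) *\<^sub>R i) ((v \<bullet> j) *\<^sub>R j))"
      by (rule bilinear_sum[OF bil[OF that]]) 
    also have "\<dots> = (\<Sum>i\<in>Basis. \<Sum>j\<in>Basis. ((u \<bullet> i) * (v \<bullet> j)) *\<^sub>R B q i j)"
      by (simp add: sum.cartesian_product bilinear_lmul[OF bil[OF that]] bilinear_rmul[OF bil[OF that]]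
          mult.commute)
    finally show ?thesis .
  qed
  show ?thesis
    using ev
  proof (rule eventually_mono, intro conjI allI)
    fix q u v assume q: "q \<in> U \<and> (\<forall>i\<in>Basis. \<forall>j\<in>Basis. dist (B q i j) (B p i j) < e / n)"
    then show "q \<in> U" by blast
    have "norm (B q u v - B p u v)
        = norm (\<Sum>i\<in>Basis. \<Sum>j\<in>Basis. ((u \<bullet> i) * (v \<bullet> j)) *\<^sub>R (B q i j - B p i j))"
      using q U exp[of q u v] exp[of p u v] by (simp add: sum_subtractf scaleR_diff_right)
    also have "\<dots> \<le> (\<Sum>i\<in>(Basis::'e set). \<Sum>j\<in>(Basis::'d set). (norm u * norm v) * (e / n))"
    proof (intro sum_norm_le)
      fix i :: 'e and j :: 'd assume ij: "i \<in> Basis" "j \<in> Basis"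
      have "norm (((u \<bullet> i) * (v \<bullet> j)) *\<^sub>R (B q i j - B p i j)) = (\<bar>u \<bullet> i\<bar> * \<bar>v \<bullet> j\<bar>) * dist (B q i j) (B p i j)"
        by (simp add: abs_mult dist_norm)
      also have "\<dots> \<le> (norm u * norm v) * (e / n)"
        using q ij by (intro mult_mono) (auto simp: Basis_le_norm intro: less_imp_le)
      finally show "norm (((u \<bullet> i) * (v \<bullet> j)) *\<^sub>R (B q i j - B p i j)) \<le> (norm u * norm v) * (e / n)" .
    qed
    also have "\<dots> = n * ((norm u * norm v) * (e / n))" by (simp add: n_def)
    also have "\<dots> = e * norm u * norm v" using n by simp
    finally show "norm (B q u v - B p u v) \<le> e * norm u * norm v" .
  qed
qed

text \<open>Polarisation.\<close>

lemma symmetric_bilinear_eqI: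
  assumes "bilinear B" "bilinear C" and sym: "\<And>u v. B u v = B v u" "\<And>u v. C u v = C v u"
    and diag: "\<And>u. B u u = C u u"
  shows "B u v = C u v"
proof -
  have "B (u + v) (u + v) = B u u + 2 *\<^sub>R B u v + B v v"
    using assms(1) by (simp add: bilinear_ladd bilinear_radd scaleR_2 sym(1)[of v u])
  moreover have "C (u + v) (u + v) = C u u + 2 *\<^sub>R C u v + C v v"
    using assms(2) by (simp add: bilinear_ladd bilinear_radd scaleR_2 sym(2)[of v u])
  ultimately have "2 *\<^sub>R B u v = 2 *\<^sub>R C u v" by (simp only: diag) simp
  then show ?thesis by simp
qed

text \<open>The smallness of \<open>\<kappa>\<close> makes the Picard operator on continuous functions over the unit
  interval a contraction in the supremum norm, so that no subdivision of the interval is required.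
  In the application \<open>\<kappa>\<close> is proportional to the length of a geodesic that may be taken short.\<close>

lemma linear_ode_exists:
  fixes F :: "real \<Rightarrow> 'e::euclidean_space \<Rightarrow> 'e"
  assumes lin: "\<And>t. t \<in> {0..1} \<Longrightarrow> linear (F t)"
    and cont: "\<And>v. continuous_on {0..1} (\<lambda>t. F t v)"
    and bnd: "\<And>t v. t \<in> {0..1} \<Longrightarrow> norm (F t v) \<le> \<kappa> * norm v"
    and \<kappa>: "0 \<le> \<kappa>" "\<kappa> < 1"
  shows "\<exists>v. v 0 = v0 \<and> (\<forall>t\<in>{0..1}. (v has_vector_derivative F t (v t)) (at t within {0..1}))"
proof -
  \<comment> \<open>Functions on the unit interval are extended constantly to the real line, where the bounded
    continuous functions form a complete space.\<close>
  define cl :: "real \<Rightarrow> real" where "cl r = max 0 (min 1 r)" for r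
  have cl: "cl r \<in> {0..1}" "0 \<le> cl r" "cl r \<le> 1" and cl_id: "r \<in> {0..1} \<Longrightarrow> cl r = r" for r
    by (auto simp: cl_def)
  have ccl: "continuous_on UNIV cl" unfolding cl_def by (intro continuous_intros)
  have cF: "continuous_on {0..1} (\<lambda>t. F t (v t))" if "continuous_on {0..1} v" for v
    by (rule linear_family_continuous_on[where U="{0..1}"]) (use lin cont that in \<open>auto intro: continuous_intros\<close>)
  define P where "P v r = v0 + integral {0..r} (\<lambda>t. F t (v t))" for v :: "real \<Rightarrow> 'e" and r
  have cP: "continuous_on {0..1} (P v)" if "continuous_on {0..1} v" for v
    unfolding P_def
    by (intro continuous_intros indefinite_integral_continuous_1 integrable_continuous_real cF that)
  have bc: "(\<lambda>r. P (apply_bcontfun v) (cl r)) \<in> bcontfun" for v :: "real \<Rightarrow>\<^sub>C 'e"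
  proof -
    have c: "continuous_on {0..1} (P v)" by (intro cP) simp
    have "continuous_on UNIV (\<lambda>r. P v (cl r))"
      by (rule continuous_on_compose2[OF c ccl]) (use cl in auto)
    moreover have "bounded (range (\<lambda>r. P v (cl r)))"
      by (rule bounded_subset[OF compact_imp_bounded[OF compact_continuous_image[OF c compact_Icc]]])
        (use cl in auto)
    ultimately show ?thesis by (simp add: bcontfun_def)
  qed
  define T where "T v = Bcontfun (\<lambda>r. P (apply_bcontfun v) (cl r))" for v
  have T: "apply_bcontfun (T v) r = P v (cl r)" for v r
    unfolding T_def by (simp add: Bcontfun_inverse[OF bc])
  have "dist (T v) (T w) \<le> \<kappa> * dist v w" for v w
  proof (rule dist_bound)
    fix r
    have sub: "{0..cl r} \<subseteq> {0..1}" using cl by auto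
    have c: "continuous_on {0..cl r} (\<lambda>t. F t (u t))" for u :: "real \<Rightarrow>\<^sub>C 'e"
      by (rule continuous_on_subset[OF cF sub]) simp
    have "dist (T v r) (T w r)
        = norm (integral {0..cl r} (\<lambda>t. F t (v t) - F t (w t)))"
      by (simp add: T P_def dist_norm integral_diff[OF integrable_continuous_real integrable_continuous_real] c)
    also have "\<dots> \<le> \<kappa> * dist v w * (cl r - 0)"
    proof (rule integral_bound)
      fix t assume "t \<in> {0..cl r}"
      then have t: "t \<in> {0..1}" using sub by auto
      have "norm (F t (v t) - F t (w t)) = norm (F t (v t - w t))"
        by (simp add: linear_diff[OF lin[OF t]])
      also have "\<dots> \<le> \<kappa> * dist v w"
        using bnd[OF t, of "v t - w t"] dist_bounded[of v t w] \<kappa>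
        by (smt (verit) dist_norm mult_left_mono)
      finally show "norm (F t (v t) - F t (w t)) \<le> \<kappa> * dist v w" .
    qed (use cl c in \<open>auto intro!: continuous_intros\<close>)
    also have "\<dots> \<le> \<kappa> * dist v w * 1" using cl \<kappa> by (intro mult_left_mono) auto
    finally show "dist (T v r) (T w r) \<le> \<kappa> * dist v w" by simp
  qed
  then obtain v where v: "T v = v" using banach_fix_type[OF \<kappa>, of T] by blast
  have veq: "v r = P v r" if "r \<in> {0..1}" for r
    using T[of v r] v cl_id[OF that] by simp
  show ?thesis
  proof (intro exI conjI ballI)
    show "apply_bcontfun v 0 = v0" using veq[of 0] by (simp add: P_def)
    fix t :: real assume t: "t \<in> {0..1}"
    have "((\<lambda>r. P v r) has_vector_derivative F t (v t)) (at t within {0..1})"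
      unfolding P_def
      by (auto intro!: derivative_eq_intros integral_has_vector_derivative cF t)
    then show "(apply_bcontfun v has_vector_derivative F t (v t)) (at t within {0..1})"
      by (rule has_vector_derivative_transform[OF t, rotated]) (use veq in auto)
  qed
qed

section \<open>Christoffel maps of a field of inner products\<close>

text \<open>This is \<^const>\<open>christoffel\<close> detached from charts: the Koszul formula for an arbitrary field \<open>G\<close>
  of bilinear forms, which allows its algebra and analysis to be done on an open subset of a
  Euclidean space.\<close>

definition chris :: "('e::euclidean_space \<Rightarrow> 'e \<Rightarrow> 'e \<Rightarrow> real) \<Rightarrow> 'e \<Rightarrow> 'e \<Rightarrow> 'e \<Rightarrow> 'e" where
  "chris G p u v = (THE z. \<forall>w. G p z w =
     (frechet_derivative (\<lambda>q. G q v w) (at p) u +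
      frechet_derivative (\<lambda>q. G q u w) (at p) v -
      frechet_derivative (\<lambda>q. G q u v) (at p) w) / 2)"

locale metric_field =
  fixes U :: "'e::euclidean_space set" and G :: "'e \<Rightarrow> 'e \<Rightarrow> 'e \<Rightarrow> real"
  assumes open_U: "open U"
    and bil: "q \<in> U \<Longrightarrow> bilinear (G q)"
    and symm: "q \<in> U \<Longrightarrow> G q u v = G q v u"
    and pos: "q \<in> U \<Longrightarrow> u \<noteq> 0 \<Longrightarrow> 0 < G q u u"
    and C1: "Ck_on 1 (\<lambda>q. G q u v) U"
begin

abbreviation DG where "DG q u v \<equiv> frechet_derivative (\<lambda>q. G q u v) (at q)"

lemma nonneg: "q \<in> U \<Longrightarrow> 0 \<le> G q u u"
  using pos[of q u] bilinear_lzero[OF bil, of q u] by (cases "u = 0") auto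

lemma cauchy_schwarz:
  assumes q: "q \<in> U"
  shows "\<bar>G q u v\<bar> \<le> sqrt (G q u u) * sqrt (G q v v)"
proof (cases "v = 0")
  case True
  then show ?thesis using bilinear_rzero[OF bil[OF q]] by simp
next
  case False
  then have vv: "G q v v > 0" using pos q by blast
  \<comment> \<open>The coefficient of the orthogonal projection of \<open>u\<close> onto \<open>v\<close>.\<close>
  define r where "r = G q u v / G q v v"
  have "0 \<le> G q (u - r *\<^sub>R v) (u - r *\<^sub>R v)" using nonneg q by blast
  also have "\<dots> = G q u u - 2 * r * G q u v + r * r * G q v v"
    using bil[OF q] by (simp add: bilinear_lsub bilinear_rsub bilinear_lmul bilinear_rmul
        symm[OF q, of v u] algebra_simps)
  also have "\<dots> = G q u u - (G q u v)\<^sup>2 / G q v v"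
    using vv by (simp add: r_def power2_eq_square field_simps)
  finally have "(G q u v)\<^sup>2 \<le> G q u u * G q v v" using vv by (simp add: field_simps)
  then have "sqrt ((G q u v)\<^sup>2) \<le> sqrt (G q u u * G q v v)" by (rule real_sqrt_le_mono)
  then show ?thesis by (simp add: real_sqrt_mult)
qed

lemma G_has_derivative: "q \<in> U \<Longrightarrow> ((\<lambda>q. G q u v) has_derivative DG q u v) (at q)"
  using C1[of u v] open_U by (auto simp: differentiable_on_eq_differentiable_at frechet_derivative_works)

lemma G_continuous: "continuous_on U (\<lambda>q. G q u v)"
  using C1[of u v] by (auto intro: differentiable_imp_continuous_on)

lemma DG_continuous: "continuous_on U (\<lambda>q. DG q u v a)"
  using C1[of u v] by simp

lemma DG_eqI:
  assumes q: "q \<in> U" and eq: "\<And>q. q \<in> U \<Longrightarrow> G q u v = h q" and h: "(h has_derivative h') (at q)"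
  shows "DG q u v = h'"
proof -
  have "((\<lambda>q. G q u v) has_derivative h') (at q)"
    by (rule has_derivative_transform_within_open[OF h open_U q]) (simp add: eq)
  then show ?thesis using frechet_derivative_at by metis
qed

lemma DG_sym: "q \<in> U \<Longrightarrow> DG q u v = DG q v u"
  by (rule DG_eqI[OF _ symm G_has_derivative])

lemma DG_linear: "q \<in> U \<Longrightarrow> linear (DG q u v)"
  using G_has_derivative has_derivative_linear by blast

lemma DG_add: "q \<in> U \<Longrightarrow> DG q (u + u') v = (\<lambda>h. DG q u v h + DG q u' v h)"
  by (rule DG_eqI[where h="\<lambda>q. G q u v + G q u' v"])
    (auto intro!: derivative_eq_intros G_has_derivative simp: bil bilinear_ladd)

lemma DG_scale: "q \<in> U \<Longrightarrow> DG q (r *\<^sub>R u) v = (\<lambda>h. r * DG q u v h)"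
  by (rule DG_eqI[where h="\<lambda>q. r * G q u v"])
    (auto intro!: derivative_eq_intros G_has_derivative simp: bil bilinear_lmul)

text \<open>The linear map sending \<open>z\<close> to the vector of the numbers \<open>G q z b\<close> over the basis is
  injective by positivity, hence surjective.\<close>

lemma riesz:
  assumes q: "q \<in> U" and l: "linear l"
  shows "\<exists>!z. \<forall>w. G q z w = l w"
proof -
  define T where "T z = (\<Sum>b\<in>Basis. G q z b *\<^sub>R b)" for z
  have T: "T z \<bullet> b = G q z b" if "b \<in> Basis" for z b using that by (simp add: T_def)
  have linT: "linear T"
    by (rule linearI) (simp_all add: T_def bilinear_ladd[OF bil[OF q]] bilinear_lmul[OF bil[OF q]]
        scaleR_add_left sum.distrib scaleR_right.sum)
  have exp: "k w = (\<Sum>b\<in>Basis. (w \<bullet> b) * k b)" if "linear k" for k :: "'e \<Rightarrow> real" and w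
    using linear_sum[OF that, of "\<lambda>i. (w \<bullet> i) *\<^sub>R i" Basis]
    by (simp add: linear_scale[OF that] euclidean_representation)
  have linG: "linear (G q z)" for z using bil[OF q] by (simp add: bilinear_def)
  have ext: "(\<forall>w. G q z w = k w) \<longleftrightarrow> (\<forall>b\<in>Basis. G q z b = k b)" if "linear k" for z k
    using exp[OF linG, of z] exp[OF that] by (metis (no_types, lifting) sum.cong)
  have "inj T"
    unfolding linear_injective_0[OF linT]
  proof (intro allI impI)
    fix z assume "T z = 0"
    then have "\<forall>b\<in>Basis. G q z b = 0" using T by (metis inner_zero_left)
    then have "G q z z = 0" using exp[OF linG, of z z] by simp
    then show "z = 0" using pos[OF q, of z] by force
  qed
  then have "surj T" using linT linear_injective_imp_surjective by blast
  then obtain z where "T z = (\<Sum>b\<in>Basis. l b *\<^sub>R b)" by (metis surjD)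
  then have z: "\<forall>w. G q z w = l w" unfolding ext[OF l] using T by (metis inner_sum_left_Basis)
  moreover have "z' = z" if "\<forall>w. G q z' w = l w" for z'
  proof -
    have "G q (z' - z) (z' - z) = 0" using that z by (simp add: bilinear_lsub[OF bil[OF q]])
    then show ?thesis using pos[OF q, of "z' - z"] by force
  qed
  ultimately show ?thesis by blast
qed

lemma chris_iff:
  assumes q: "q \<in> U"
  shows "z = chris G q u v \<longleftrightarrow> (\<forall>w. G q z w = (DG q v w u + DG q u w v - DG q u v w) / 2)"
proof -
  have "linear (\<lambda>w. (DG q v w u + DG q u w v - DG q u v w) / 2)"
  proof (rule linearI)
    fix w w' and r :: real
    have *: "DG q v (w + w') = (\<lambda>h. DG q v w h + DG q v w' h)" "DG q v (r *\<^sub>R w) = (\<lambda>h. r * DG q v w h)"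
      for v w w' and r :: real
      using DG_add[OF q, of w w' v] DG_scale[OF q, of r w v] by (simp_all add: DG_sym[OF q, of v])
    show "(DG q v (w + w') u + DG q u (w + w') v - DG q u v (w + w')) / 2 =
       (DG q v w u + DG q u w v - DG q u v w) / 2 + (DG q v w' u + DG q u w' v - DG q u v w') / 2"
      by (simp add: * linear_add[OF DG_linear[OF q]] field_simps)
    show "(DG q v (r *\<^sub>R w) u + DG q u (r *\<^sub>R w) v - DG q u v (r *\<^sub>R w)) / 2 =
       r *\<^sub>R ((DG q v w u + DG q u w v - DG q u v w) / 2)"
      by (simp add: * linear_scale[OF DG_linear[OF q]] field_simps)
  qed
  note ex1 = riesz[OF q this]
  show ?thesis
    using theI'[OF ex1] ex1 unfolding chris_def by blast
qed

lemmas chris_eq = chris_iff[THEN iffD1, OF _ refl, rule_format]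

lemma chris_sym: "q \<in> U \<Longrightarrow> chris G q u v = chris G q v u"
  by (simp add: chris_iff chris_eq DG_sym[of q u v])

lemma chris_bilinear:
  assumes q: "q \<in> U"
  shows "bilinear (chris G q)"
proof -
  note [simp] = bilinear_ladd[OF bil[OF q]] bilinear_lmul[OF bil[OF q]] DG_add[OF q] DG_scale[OF q]
    linear_add[OF DG_linear[OF q]] linear_scale[OF DG_linear[OF q]]
  have lin: "linear (\<lambda>u. chris G q u v)" for v
  proof (rule linearI)
    show "chris G q (u + u') v = chris G q u v + chris G q u' v" for u u'
      by (rule sym) (simp add: chris_iff[OF q] chris_eq[OF q] field_simps)
    show "chris G q (r *\<^sub>R u) v = r *\<^sub>R chris G q u v" for r u
      by (rule sym) (simp add: chris_iff[OF q] chris_eq[OF q] field_simps)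
  qed
  then have "linear (\<lambda>v. chris G q u v)" for u by (simp add: chris_sym[OF q, of u])
  with lin show ?thesis by (simp add: bilinear_def)
qed

text \<open>The connection is metric: two of the three derivatives in the Koszul formula cancel when it
  is added to its copy with \<open>v\<close> and \<open>w\<close> exchanged.\<close>

lemma chris_compatible:
  assumes q: "q \<in> U"
  shows "DG q v w u = G q (chris G q u v) w + G q v (chris G q u w)"
proof -
  have "G q v (chris G q u w) = G q (chris G q u w) v" using symm q by blast
  then show ?thesis
    by (simp add: chris_eq[OF q] DG_sym[OF q, of w v] field_simps)
qed

text \<open>Compactness of the unit sphere gives a positive lower bound at the point \<open>p\<close>, and continuity
  preserves half of it nearby.\<close>

lemma uniformly_positive:
  assumes p: "p \<in> U"
  obtains k where "k > 0" "\<forall>\<^sub>F q in nhds p. q \<in> U \<and> (\<forall>w. k * (norm w)\<^sup>2 \<le> G q w w)"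
proof -
  have linG: "linear (G p w)" for w using bil[OF p] by (simp add: bilinear_def)
  have cont: "continuous_on (sphere 0 1) (\<lambda>w. G p w w)"
  proof -
    have "continuous_on (sphere 0 1) (\<lambda>w. G p (id w) w)"
      by (rule linear_family_continuous_on[where U=UNIV and F="G p"])
        (use bil[OF p] in \<open>auto simp: bilinear_def linear_conv_bounded_linear intro: linear_continuous_on\<close>)
    then show ?thesis by simp
  qed
  have "sphere (0::'e) 1 \<noteq> {}"
    by (simp add: sphere_eq_empty)
  then obtain w0 where w0: "w0 \<in> sphere 0 1" "\<And>w. w \<in> sphere 0 1 \<Longrightarrow> G p w0 w0 \<le> G p w w"
    using continuous_attains_inf[OF compact_sphere _ cont] by blast
  define k where "k = G p w0 w0"
  have k: "k > 0" unfolding k_def using w0(1) by (intro pos p) auto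
  have low: "k * (norm w)\<^sup>2 \<le> G p w w" for w
  proof (cases "w = 0")
    case True then show ?thesis using nonneg[OF p] by simp
  next
    case False
    define z where "z = (1 / norm w) *\<^sub>R w"
    have "w = norm w *\<^sub>R z" using False by (simp add: z_def)
    then have "G p w w = (norm w)\<^sup>2 * G p z z"
      by (metis bilinear_lmul[OF bil[OF p]] bilinear_rmul[OF bil[OF p]] mult.assoc power2_eq_square real_scaleR_def)
    moreover have "k \<le> G p z z" unfolding k_def using False by (intro w0) (simp add: z_def)
    ultimately show ?thesis by (simp add: mult.commute[of "(norm w)\<^sup>2"] mult_right_mono)
  qed
  have "\<forall>\<^sub>F q in nhds p. q \<in> U \<and> (\<forall>u v. norm (G q u v - G p u v) \<le> k / 2 * norm u * norm v)"
    using bil by (rule bilinear_family_close[OF _ open_U p G_continuous half_gt_zero[OF k]])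
  then have "\<forall>\<^sub>F q in nhds p. q \<in> U \<and> (\<forall>w. (k/2) * (norm w)\<^sup>2 \<le> G q w w)"
  proof (rule eventually_mono, intro conjI allI)
    fix q w assume *: "q \<in> U \<and> (\<forall>u v. norm (G q u v - G p u v) \<le> k / 2 * norm u * norm v)"
    then show "q \<in> U" by blast
    from * have "norm (G q w w - G p w w) \<le> k / 2 * (norm w)\<^sup>2"
      by (metis mult.assoc power2_eq_square)
    with low[of w] show "(k/2) * (norm w)\<^sup>2 \<le> G q w w" unfolding real_norm_def by argo
  qed
  with k show thesis by (intro that[of "k/2"]) auto
qed

text \<open>The difference \<open>e\<close> of the Christoffel vectors at \<open>q\<close> and \<open>p\<close> satisfies \<open>k \<parallel>e\<parallel>\<^sup>2 \<le> G q e e\<close>,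
  and by the Koszul formula the right-hand side is at most \<open>\<parallel>e\<parallel>\<close> times a quantity that depends
  continuously on \<open>q\<close> and vanishes at \<open>p\<close>.\<close>

lemma chris_continuous: "continuous_on U (\<lambda>q. chris G q u v)"
  unfolding continuous_on_eq_continuous_at[OF open_U]
proof
  fix p assume p: "p \<in> U"
  define K where "K q w = (DG q v w u + DG q u w v - DG q u v w) / 2" for q w
  obtain k where k: "k > 0" "\<forall>\<^sub>F q in nhds p. q \<in> U \<and> (\<forall>w. k * (norm w)\<^sup>2 \<le> G q w w)"
    using uniformly_positive[OF p] by blast
  let ?z = "\<lambda>q. chris G q u v"
  let ?S = "\<lambda>q. \<Sum>i\<in>Basis. \<bar>K q i - G q (?z p) i\<bar>"
  have "continuous_on U ?S"
    unfolding K_def by (intro continuous_intros G_continuous DG_continuous) auto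
  then have "isCont ?S p" using p open_U continuous_on_eq_continuous_at by blast
  then have "(?S \<longlongrightarrow> ?S p) (at p)" by (simp add: isCont_def)
  moreover have "K p i = G p (?z p) i" for i by (simp add: K_def chris_eq[OF p])
  then have "?S p = 0" by simp
  ultimately have S0: "(?S \<longlongrightarrow> 0) (at p)" by simp
  have "norm (?z q - ?z p) \<le> ?S q / k" if q: "q \<in> U" and low: "\<forall>w. k * (norm w)\<^sup>2 \<le> G q w w" for q
  proof (cases "?z q = ?z p")
    case True
    then show ?thesis using k by (simp add: sum_nonneg)
  next
    case False
    let ?e = "?z q - ?z p"
    have linG: "linear (G q w)" for w using bil[OF q] by (simp add: bilinear_def)
    have "k * (norm ?e)\<^sup>2 \<le> G q ?e ?e" using low by blast
    also have "\<dots> = (\<Sum>i\<in>Basis. (?e \<bullet> i) * G q ?e i)"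
      using linear_sum[OF linG, of ?e "\<lambda>i. (?e \<bullet> i) *\<^sub>R i" Basis]
      by (simp add: linear_scale[OF linG] euclidean_representation)
    also have "\<dots> = (\<Sum>i\<in>Basis. (?e \<bullet> i) * (K q i - G q (?z p) i))"
      by (simp add: bilinear_lsub[OF bil[OF q]] chris_eq[OF q] K_def)
    also have "\<dots> \<le> (\<Sum>i\<in>Basis. norm ?e * \<bar>K q i - G q (?z p) i\<bar>)"
    proof (rule sum_mono)
      fix i :: 'e assume "i \<in> Basis"
      have "(?e \<bullet> i) * (K q i - G q (?z p) i) \<le> \<bar>?e \<bullet> i\<bar> * \<bar>K q i - G q (?z p) i\<bar>"
        by (metis abs_ge_self abs_mult)
      also have "\<dots> \<le> norm ?e * \<bar>K q i - G q (?z p) i\<bar>"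
        using \<open>i \<in> Basis\<close> by (intro mult_right_mono Basis_le_norm) auto
      finally show "(?e \<bullet> i) * (K q i - G q (?z p) i) \<le> norm ?e * \<bar>K q i - G q (?z p) i\<bar>" .
    qed
    also have "\<dots> = norm ?e * ?S q" by (simp add: sum_distrib_left)
    finally have "norm ?e * (k * norm ?e) \<le> norm ?e * ?S q" by (simp add: power2_eq_square algebra_simps)
    then have "k * norm ?e \<le> ?S q" using False by simp
    then show ?thesis using k(1) by (simp add: field_simps)
  qed
  then have ev: "\<forall>\<^sub>F q in at p. norm (?z q - ?z p) \<le> ?S q / k"
    using k(2) unfolding eventually_at_filter by (auto elim: eventually_mono)
  have "((\<lambda>q. ?S q / k) \<longlongrightarrow> 0 / k) (at p)"
    by (intro tendsto_divide S0 tendsto_const) (use k in auto)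
  then have "((\<lambda>q. ?z q - ?z p) \<longlongrightarrow> 0) (at p)"
    by (intro Lim_null_comparison[OF ev]) simp
  then show "isCont ?z p" by (simp add: isCont_def LIM_zero_iff)
qed

text \<open>Coordinate form of the statement that inner products of parallel fields are constant. The
  equations for \<open>u\<close> and \<open>v\<close> are required at the single time \<open>t\<close> only; this is what later allows
  \<open>u\<close> to be a family of end values of different transports instead of a parallel field.\<close>

lemma parallel_product_deriv:
  assumes X: "X t \<in> U" "(X has_vector_derivative y) (at t within S)" and t: "t \<in> S"
    and u: "(u has_vector_derivative - chris G (X t) y (u t)) (at t within S)"
    and v: "(v has_vector_derivative - chris G (X t) y (v t)) (at t within S)"
  shows "((\<lambda>s. G (X s) (u s) (v s)) has_vector_derivative 0) (at t within S)"
proof -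
  note b = bil[OF X(1)]
  have "((\<lambda>s. G (X s) (u s) (v s)) has_derivative
     (\<lambda>h. DG (X t) (u t) (v t) (h *\<^sub>R y) + G (X t) (h *\<^sub>R - chris G (X t) y (u t)) (v t)
       + G (X t) (u t) (h *\<^sub>R - chris G (X t) y (v t)))) (at t within S)"
    by (rule bilinear_family_has_derivative[where G=G and X=X, OF bil open_U X(1) G_has_derivative[OF X(1)]])
      (use X u v t in \<open>auto simp: has_vector_derivative_def\<close>)
  moreover have "DG (X t) (u t) (v t) (h *\<^sub>R y) + G (X t) (h *\<^sub>R - chris G (X t) y (u t)) (v t)
       + G (X t) (u t) (h *\<^sub>R - chris G (X t) y (v t)) = 0" for h
    using b linear_scale[OF DG_linear[OF X(1)]]
    by (simp add: bilinear_lmul bilinear_rmul bilinear_lneg bilinear_rneg chris_compatible[OF X(1)] algebra_simps)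
  ultimately show ?thesis by (simp add: has_vector_derivative_def)
qed

end

section \<open>Charts, tangent vectors and gradients\<close>

locale rmanifold =
  fixes A :: "('a::{t2_space, second_countable_topology}, 'e::euclidean_space) chart set"
    and g :: "('a, 'e) metric"
  assumes riem: "riemannian_manifold A g"
begin

lemma atlas: "smooth_atlas A" and metric: "riemannian_metric A g"
  using riem by (auto simp: riemannian_manifold_def)

lemma chart_exists: obtains c where "c \<in> A" "x \<in> fst c"
  using atlas unfolding smooth_atlas_def by blast

lemma open_domain: "c \<in> A \<Longrightarrow> open (fst c)"
  and open_range: "c \<in> A \<Longrightarrow> open (snd c ` fst c)"
  and chart_homeo: "c \<in> A \<Longrightarrow> homeomorphism (fst c) (snd c ` fst c) (snd c) (chart_inv c)"
  using atlas unfolding smooth_atlas_def by auto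

lemma chart_left: "c \<in> A \<Longrightarrow> x \<in> fst c \<Longrightarrow> chart_inv c (snd c x) = x"
  and chart_right: "c \<in> A \<Longrightarrow> q \<in> snd c ` fst c \<Longrightarrow> snd c (chart_inv c q) = q"
  and chart_inv_mem: "c \<in> A \<Longrightarrow> q \<in> snd c ` fst c \<Longrightarrow> chart_inv c q \<in> fst c"
  and chart_continuous: "c \<in> A \<Longrightarrow> continuous_on (fst c) (snd c)"
  and chart_inv_continuous: "c \<in> A \<Longrightarrow> continuous_on (snd c ` fst c) (chart_inv c)"
  using chart_homeo[of c] unfolding homeomorphism_def by auto

lemma open_overlap:
  assumes "c \<in> A" "c' \<in> A"
  shows "open (snd c ` (fst c \<inter> fst c'))"
proof -
  have "snd c ` (fst c \<inter> fst c') = chart_inv c -` fst c' \<inter> snd c ` fst c"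
    using chart_left[OF assms(1)] by (force simp: image_iff)
  then show ?thesis
    using continuous_open_preimage[OF chart_inv_continuous open_range open_domain] assms
    by (simp add: Int_commute)
qed

abbreviation DT :: "('a, 'e) chart \<Rightarrow> ('a, 'e) chart \<Rightarrow> 'e \<Rightarrow> 'e \<Rightarrow> 'e" where
  "DT c c' q \<equiv> frechet_derivative (snd c' \<circ> chart_inv c) (at q)"

lemma transition_Ck: "c \<in> A \<Longrightarrow> c' \<in> A \<Longrightarrow> Ck_on k (snd c' \<circ> chart_inv c) (snd c ` (fst c \<inter> fst c'))"
  using atlas unfolding smooth_atlas_def smooth_on_def by blast

lemma transition_has_derivative:
  assumes "c \<in> A" "c' \<in> A" "q \<in> snd c ` (fst c \<inter> fst c')"
  shows "((snd c' \<circ> chart_inv c) has_derivative DT c c' q) (at q)"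
  using transition_Ck[OF assms(1,2), of 1] assms(3) open_overlap[OF assms(1,2)]
  by (auto simp: differentiable_on_eq_differentiable_at frechet_derivative_works)

lemma transition_derivative_differentiable:
  assumes "c \<in> A" "c' \<in> A" "q \<in> snd c ` (fst c \<inter> fst c')"
  shows "((\<lambda>p. DT c c' p v) has_derivative frechet_derivative (\<lambda>p. DT c c' p v) (at q)) (at q)"
  using transition_Ck[OF assms(1,2), of "Suc (Suc 0)"] assms(3) open_overlap[OF assms(1,2)]
  by (auto simp: differentiable_on_eq_differentiable_at frechet_derivative_works)

lemma DT_linear:
  assumes "c \<in> A" "c' \<in> A" "x \<in> fst c" "x \<in> fst c'"
  shows "linear (DT c c' (snd c x))"
  using has_derivative_linear[OF transition_has_derivative[OF assms(1,2)]] assms by blast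

lemma DT_chain:
  assumes A: "c \<in> A" "c' \<in> A" "c'' \<in> A" and x: "x \<in> fst c" "x \<in> fst c'" "x \<in> fst c''"
  shows "DT c c'' (snd c x) = (\<lambda>u. DT c' c'' (snd c' x) (DT c c' (snd c x) u))"
proof (rule frechet_derivative_eqI_open)
  let ?U = "snd c ` (fst c \<inter> fst c') \<inter> snd c ` (fst c \<inter> fst c'')"
  show "open ?U" using open_overlap A by blast
  show "snd c x \<in> ?U" using x by blast
  show "(snd c'' \<circ> chart_inv c) q = ((snd c'' \<circ> chart_inv c') \<circ> (snd c' \<circ> chart_inv c)) q" if q: "q \<in> ?U" for q
  proof -
    obtain y where "y \<in> fst c" "y \<in> fst c'" "q = snd c y" using q by blast
    then show ?thesis using A by (simp add: chart_left)
  qed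
  have "((snd c' \<circ> chart_inv c) has_derivative DT c c' (snd c x)) (at (snd c x))"
    by (rule transition_has_derivative) (use A x in auto)
  moreover have "((snd c'' \<circ> chart_inv c') has_derivative DT c' c'' (snd c' x)) (at ((snd c' \<circ> chart_inv c) (snd c x)))"
    using transition_has_derivative[OF A(2,3), of "snd c' x"] x A by (auto simp: chart_left)
  ultimately show "(((snd c'' \<circ> chart_inv c') \<circ> (snd c' \<circ> chart_inv c)) has_derivative
      (\<lambda>u. DT c' c'' (snd c' x) (DT c c' (snd c x) u))) (at (snd c x))"
    using diff_chain_at by (fastforce simp: o_def)
qed

lemma DT_id:
  assumes "c \<in> A" "x \<in> fst c"
  shows "DT c c (snd c x) = (\<lambda>u. u)"
  by (rule frechet_derivative_eqI_open[OF open_range, where h="\<lambda>q. q"])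
    (use assms in \<open>auto simp: chart_left\<close>)

lemma tangent_of_at [simp]: "c \<in> A \<Longrightarrow> x \<in> fst c \<Longrightarrow> tangent_of A c x u c = u"
  by (simp add: tangent_of_def DT_id)

lemma tangent_spaceI:
  assumes "\<And>c. \<not> (c \<in> A \<and> x \<in> fst c) \<Longrightarrow> v c = 0"
    and "\<And>c c'. c \<in> A \<Longrightarrow> c' \<in> A \<Longrightarrow> x \<in> fst c \<Longrightarrow> x \<in> fst c' \<Longrightarrow> v c' = DT c c' (snd c x) (v c)"
  shows "v \<in> tangent_space A x"
  unfolding tangent_space_def using assms by blast

lemma tangent_outside: "v \<in> tangent_space A x \<Longrightarrow> \<not> (c \<in> A \<and> x \<in> fst c) \<Longrightarrow> v c = 0"
  and tangent_transition:
    "v \<in> tangent_space A x \<Longrightarrow> c \<in> A \<Longrightarrow> c' \<in> A \<Longrightarrow> x \<in> fst c \<Longrightarrow> x \<in> fst c' \<Longrightarrow>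
      v c' = DT c c' (snd c x) (v c)"
  unfolding tangent_space_def by blast+

lemma tangent_of_mem:
  assumes "c \<in> A" "x \<in> fst c"
  shows "tangent_of A c x u \<in> tangent_space A x"
proof (rule tangent_spaceI)
  fix c1 c2 assume *: "c1 \<in> A" "c2 \<in> A" "x \<in> fst c1" "x \<in> fst c2"
  then have "tangent_of A c x u c2 = DT c c2 (snd c x) u" "tangent_of A c x u c1 = DT c c1 (snd c x) u"
    by (simp_all add: tangent_of_def)
  with DT_chain[of c c1 c2 x] assms * show "tangent_of A c x u c2 = DT c1 c2 (snd c1 x) (tangent_of A c x u c1)"
    by metis
qed (auto simp: tangent_of_def)

lemma tangent_of_coord:
  assumes "c \<in> A" "x \<in> fst c" "v \<in> tangent_space A x"
  shows "tangent_of A c x (v c) = v"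
proof
  fix c'
  show "tangent_of A c x (v c) c' = v c'"
  proof (cases "c' \<in> A \<and> x \<in> fst c'")
    case True
    then show ?thesis using tangent_transition[OF assms(3,1) _ assms(2), of c'] by (simp add: tangent_of_def)
  next
    case False
    then show ?thesis using tangent_outside[OF assms(3) False] by (auto simp: tangent_of_def)
  qed
qed

lemma tangent_eqI:
  "c \<in> A \<Longrightarrow> x \<in> fst c \<Longrightarrow> v \<in> tangent_space A x \<Longrightarrow> w \<in> tangent_space A x \<Longrightarrow> v c = w c \<Longrightarrow> v = w"
  by (metis tangent_of_coord)

lemma tadd_mem:
  assumes v: "v \<in> tangent_space A x" and w: "w \<in> tangent_space A x"
  shows "tadd v w \<in> tangent_space A x"
  unfolding tadd_def
proof (rule tangent_spaceI)
  fix c c' assume c: "c \<in> A" "c' \<in> A" "x \<in> fst c" "x \<in> fst c'"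
  show "v c' + w c' = DT c c' (snd c x) (v c + w c)"
    using tangent_transition[OF v c] tangent_transition[OF w c] linear_add[OF DT_linear[OF c]] by metis
qed (simp add: tangent_outside[OF v] tangent_outside[OF w])

lemma tscale_mem:
  assumes v: "v \<in> tangent_space A x"
  shows "tscale r v \<in> tangent_space A x"
  unfolding tscale_def
proof (rule tangent_spaceI)
  fix c c' assume c: "c \<in> A" "c' \<in> A" "x \<in> fst c" "x \<in> fst c'"
  show "r *\<^sub>R v c' = DT c c' (snd c x) (r *\<^sub>R v c)"
    using tangent_transition[OF v c] linear_scale[OF DT_linear[OF c]] by metis
qed (simp add: tangent_outside[OF v])

lemma tangent_of_add: "c \<in> A \<Longrightarrow> x \<in> fst c \<Longrightarrow> tangent_of A c x (u + v) = tadd (tangent_of A c x u) (tangent_of A c x v)"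
  by (rule tangent_eqI) (auto simp: tangent_of_mem tadd_mem, simp add: tadd_def)

lemma tangent_of_scale: "c \<in> A \<Longrightarrow> x \<in> fst c \<Longrightarrow> tangent_of A c x (r *\<^sub>R u) = tscale r (tangent_of A c x u)"
  by (rule tangent_eqI) (auto simp: tangent_of_mem tscale_mem, simp add: tscale_def)

lemma metric_coord_eq:
  assumes "c \<in> A" "x \<in> fst c" "v \<in> tangent_space A x" "w \<in> tangent_space A x"
  shows "metric_coord A g c (snd c x) (v c) (w c) = g x v w"
  using assms by (simp add: metric_coord_def chart_left tangent_of_coord)

lemma metric_facts:
  assumes "u \<in> tangent_space A x" "v \<in> tangent_space A x"
  shows metric_sym: "g x u v = g x v u"
    and metric_scale: "g x (tscale r u) v = r * g x u v"
    and metric_pos: "u \<noteq> (\<lambda>c. 0) \<Longrightarrow> 0 < g x u u"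
  using metric assms unfolding riemannian_metric_def by blast+

lemma metric_add:
  "u \<in> tangent_space A x \<Longrightarrow> v \<in> tangent_space A x \<Longrightarrow> w \<in> tangent_space A x \<Longrightarrow>
    g x (tadd u v) w = g x u w + g x v w"
  using metric unfolding riemannian_metric_def by blast

lemma metric_add_right:
  "u \<in> tangent_space A x \<Longrightarrow> v \<in> tangent_space A x \<Longrightarrow> w \<in> tangent_space A x \<Longrightarrow>
    g x w (tadd u v) = g x w u + g x w v"
  by (metis metric_add metric_sym tadd_mem)

lemma metric_scale_right:
  "u \<in> tangent_space A x \<Longrightarrow> v \<in> tangent_space A x \<Longrightarrow> g x u (tscale r v) = r * g x u v"
  by (metis metric_scale metric_sym tscale_mem)

lemma metric_field_coord:
  assumes c: "c \<in> A"
  shows "metric_field (snd c ` fst c) (metric_coord A g c)"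
proof
  show "open (snd c ` fst c)" using c by (rule open_range)
  fix q u v
  show "Ck_on 1 (\<lambda>q. metric_coord A g c q u v) (snd c ` fst c)"
    using metric c unfolding riemannian_metric_def smooth_on_def by blast
  assume q: "q \<in> snd c ` fst c"
  let ?x = "chart_inv c q"
  have x: "?x \<in> fst c" using chart_inv_mem[OF c q] .
  note t = tangent_of_mem[OF c x]
  show "bilinear (metric_coord A g c q)"
    unfolding bilinear_def
    by (intro conjI allI linearI) (simp_all add: metric_coord_def tangent_of_add[OF c x] tangent_of_scale[OF c x]
        metric_add metric_add_right metric_scale metric_scale_right t)
  show "metric_coord A g c q u v = metric_coord A g c q v u"
    by (simp add: metric_coord_def metric_sym[OF t t])
  assume "u \<noteq> 0"
  then have "tangent_of A c ?x u \<noteq> (\<lambda>c. 0)" using tangent_of_at[OF c x, of u] by metis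
  then show "0 < metric_coord A g c q u u"
    unfolding metric_coord_def using metric_pos t by blast
qed

lemma christoffel_eq_chris: "christoffel A g c = chris (metric_coord A g c)"
  by (intro ext) (simp add: christoffel_def chris_def)

lemma tnorm_coord:
  "c \<in> A \<Longrightarrow> x \<in> fst c \<Longrightarrow> v \<in> tangent_space A x \<Longrightarrow> tnorm g x v = sqrt (metric_coord A g c (snd c x) (v c) (v c))"
  by (simp add: tnorm_def metric_coord_eq)

lemma metric_cauchy_schwarz:
  assumes "u \<in> tangent_space A x" "v \<in> tangent_space A x"
  shows "\<bar>g x u v\<bar> \<le> tnorm g x u * tnorm g x v"
proof -
  obtain c where c: "c \<in> A" "x \<in> fst c" by (rule chart_exists)
  show ?thesis
    using metric_field.cauchy_schwarz[OF metric_field_coord[OF c(1)], of "snd c x" "u c" "v c"] assms c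
    by (simp add: metric_coord_eq tnorm_coord)
qed

lemma metric_self_nonneg:
  assumes u: "u \<in> tangent_space A x"
  shows "0 \<le> g x u u"
proof -
  obtain c where c: "c \<in> A" "x \<in> fst c" by (rule chart_exists)
  show ?thesis
    using metric_field.nonneg[OF metric_field_coord[OF c(1)], of "snd c x" "u c"] c u
    by (simp add: metric_coord_eq)
qed

lemma tnorm_nonneg: "u \<in> tangent_space A x \<Longrightarrow> 0 \<le> tnorm g x u"
  by (simp add: tnorm_def metric_self_nonneg)

lemma tnorm_square: "u \<in> tangent_space A x \<Longrightarrow> (tnorm g x u)\<^sup>2 = g x u u"
  by (simp add: tnorm_def metric_self_nonneg)

lemma tnorm_scale: "u \<in> tangent_space A x \<Longrightarrow> tnorm g x (tscale r u) = \<bar>r\<bar> * tnorm g x u"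
  by (simp add: tnorm_def metric_scale metric_scale_right tscale_mem real_sqrt_mult flip: power2_eq_square mult.assoc)

lemma chart_derivative_transition:
  fixes f :: "'a \<Rightarrow> 'b::real_normed_vector"
  assumes A: "c \<in> A" "c' \<in> A" and x: "x \<in> fst c" "x \<in> fst c'"
    and f: "((f \<circ> chart_inv c') has_derivative F) (at (snd c' x))"
  shows "frechet_derivative (f \<circ> chart_inv c) (at (snd c x)) = (\<lambda>u. F (DT c c' (snd c x) u))"
proof (rule frechet_derivative_eqI_open)
  let ?U = "snd c ` (fst c \<inter> fst c')"
  show "open ?U" using open_overlap A by blast
  show "snd c x \<in> ?U" using x by blast
  show "(f \<circ> chart_inv c) q = ((f \<circ> chart_inv c') \<circ> (snd c' \<circ> chart_inv c)) q" if "q \<in> ?U" for q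
    using that A by (auto simp: chart_left)
  have "((snd c' \<circ> chart_inv c) has_derivative DT c c' (snd c x)) (at (snd c x))"
    by (rule transition_has_derivative) (use A x in auto)
  moreover have "((f \<circ> chart_inv c') has_derivative F) (at ((snd c' \<circ> chart_inv c) (snd c x)))"
    using f x A by (simp add: chart_left)
  ultimately show "(((f \<circ> chart_inv c') \<circ> (snd c' \<circ> chart_inv c)) has_derivative
      (\<lambda>u. F (DT c c' (snd c x) u))) (at (snd c x))"
    using diff_chain_at by (fastforce simp: o_def)
qed

lemma C1_function_has_derivative:
  assumes "C1_function A f" "c \<in> A" "x \<in> fst c"
  shows "((f \<circ> chart_inv c) has_derivative frechet_derivative (f \<circ> chart_inv c) (at (snd c x))) (at (snd c x))"
  using assms open_range[OF assms(2)] unfolding C1_function_def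
  by (auto simp: differentiable_on_eq_differentiable_at frechet_derivative_works)

text \<open>The Riesz representative in one chart serves for all charts, because differentials and
  tangent vectors transform by the same transition derivatives.\<close>

lemma gradient:
  assumes f: "C1_function A f"
  shows "grad A g f x \<in> tangent_space A x" (is ?A)
    and "c \<in> A \<Longrightarrow> x \<in> fst c \<Longrightarrow> u \<in> tangent_space A x \<Longrightarrow>
      g x (grad A g f x) u = frechet_derivative (f \<circ> chart_inv c) (at (snd c x)) (u c)"
proof -
  obtain c0 where c0: "c0 \<in> A" "x \<in> fst c0" by (rule chart_exists)
  interpret mf: metric_field "snd c0 ` fst c0" "metric_coord A g c0" by (rule metric_field_coord[OF c0(1)])
  let ?D = "\<lambda>c. frechet_derivative (f \<circ> chart_inv c) (at (snd c x))"
  have lin: "linear (?D c0)"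
    using C1_function_has_derivative[OF f c0] has_derivative_linear by blast
  have mem: "snd c0 x \<in> snd c0 ` fst c0" using c0 by blast
  have Dc: "?D c (u c) = ?D c0 (u c0)" if "c \<in> A" "x \<in> fst c" "u \<in> tangent_space A x" for c u
    using chart_derivative_transition[OF that(1) c0(1) that(2) c0(2) C1_function_has_derivative[OF f c0]]
      tangent_transition[OF that(3,1) c0(1) that(2) c0(2)] by simp
  obtain z where z: "\<And>w. metric_coord A g c0 (snd c0 x) z w = ?D c0 w"
    and z1: "\<And>z'. (\<forall>w. metric_coord A g c0 (snd c0 x) z' w = ?D c0 w) \<Longrightarrow> z' = z"
    using mf.riesz[OF mem lin] by metis
  let ?P = "\<lambda>v. v \<in> tangent_space A x \<and> (\<forall>u\<in>tangent_space A x. \<forall>c\<in>A. x \<in> fst c \<longrightarrow> g x v u = ?D c (u c))"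
  have "?P (tangent_of A c0 x z)"
  proof (intro conjI ballI impI)
    show t: "tangent_of A c0 x z \<in> tangent_space A x" using c0 by (rule tangent_of_mem)
    fix u c assume u: "u \<in> tangent_space A x" and c: "c \<in> A" "x \<in> fst c"
    show "g x (tangent_of A c0 x z) u = ?D c (u c)"
      using metric_coord_eq[OF c0 t u] z[of "u c0"] Dc[OF c u] tangent_of_at[OF c0] by metis
  qed
  moreover have "v = tangent_of A c0 x z" if v: "?P v" for v
  proof -
    have "metric_coord A g c0 (snd c0 x) (v c0) w = ?D c0 w" for w
    proof -
      have t: "tangent_of A c0 x w \<in> tangent_space A x" using c0 by (rule tangent_of_mem)
      show ?thesis using metric_coord_eq[OF c0, of v "tangent_of A c0 x w"] v t c0 by simp
    qed
    then have "v c0 = z" by (intro z1) blast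
    then show ?thesis using tangent_of_coord[OF c0, of v] v by simp
  qed
  ultimately have "?P (grad A g f x)" unfolding grad_def by (rule theI)
  then show ?A and "c \<in> A \<Longrightarrow> x \<in> fst c \<Longrightarrow> u \<in> tangent_space A x \<Longrightarrow>
      g x (grad A g f x) u = ?D c (u c)" by auto
qed

end

section \<open>Curves, lengths and geodesics\<close>

context rmanifold
begin

lemma eventually_in_chart:
  assumes "continuous_on I \<gamma>" "t \<in> I" "c \<in> A" "\<gamma> t \<in> fst c"
  shows "\<forall>\<^sub>F s in at t within I. \<gamma> s \<in> fst c"
  using assms open_domain[of c] topological_tendstoD unfolding continuous_on_def by blast

lemma C1_curve_has_velocity:
  assumes "C1_curve A I \<gamma>" "t \<in> I" "c \<in> A" "\<gamma> t \<in> fst c"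
  shows "((snd c \<circ> \<gamma>) has_vector_derivative velocity A I \<gamma> t c) (at t within I)"
  using assms unfolding C1_curve_def velocity_def by (auto simp: vector_derivative_works)

text \<open>The case of a subset \<open>I\<close> with \<open>a = 0\<close> and \<open>e = 1\<close> is restriction. The assumption on \<open>I\<close> says
  that it has no isolated points, so that one-sided velocities at end points agree with the
  two-sided ones.\<close>

lemma affine_reparametrisation:
  assumes \<gamma>: "C1_curve A UNIV \<gamma>" and nb: "\<And>t. t \<in> I \<Longrightarrow> at t within I \<noteq> bot"
  shows velocity_affine: "t \<in> I \<Longrightarrow> velocity A I (\<lambda>r. \<gamma> (a + r * e)) t = tscale e (velocity A UNIV \<gamma> (a + t * e))"
    and C1_curve_affine: "C1_curve A I (\<lambda>r. \<gamma> (a + r * e))"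
proof -
  let ?\<beta> = "\<lambda>r. \<gamma> (a + r * e)"
  have D: "((snd c \<circ> ?\<beta>) has_vector_derivative e *\<^sub>R velocity A UNIV \<gamma> (a + t * e) c) (at t within I)"
    if "c \<in> A" "?\<beta> t \<in> fst c" for c t
  proof -
    have "((\<lambda>r. a + r * e) has_vector_derivative e) (at t)"
      by (auto intro!: derivative_eq_intros simp: has_vector_derivative_def)
    moreover have "((snd c \<circ> \<gamma>) has_vector_derivative velocity A UNIV \<gamma> (a + t * e) c) (at (a + t * e))"
      using C1_curve_has_velocity[OF \<gamma>, of "a + t * e" c] that by simp
    ultimately have "((snd c \<circ> \<gamma>) \<circ> (\<lambda>r. a + r * e) has_vector_derivative e *\<^sub>R velocity A UNIV \<gamma> (a + t * e) c) (at t)"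
      by (rule vector_diff_chain_at)
    then show ?thesis by (simp add: o_def has_vector_derivative_at_within)
  qed
  show vel: "velocity A I ?\<beta> t = tscale e (velocity A UNIV \<gamma> (a + t * e))" if "t \<in> I" for t
  proof
    fix c
    show "velocity A I ?\<beta> t c = tscale e (velocity A UNIV \<gamma> (a + t * e)) c"
    proof (cases "c \<in> A \<and> ?\<beta> t \<in> fst c")
      case True
      then have "vector_derivative (snd c \<circ> ?\<beta>) (at t within I) = e *\<^sub>R velocity A UNIV \<gamma> (a + t * e) c"
        using vector_derivative_within[OF nb[OF that] D] by blast
      moreover have "velocity A I ?\<beta> t c = vector_derivative (snd c \<circ> ?\<beta>) (at t within I)"
        using True by (simp add: velocity_def)
      ultimately show ?thesis by (simp add: tscale_def)
    next
      case False
      then show ?thesis by (auto simp: velocity_def tscale_def)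
    qed
  qed
  show "C1_curve A I ?\<beta>"
    unfolding C1_curve_def
  proof (intro conjI ballI impI)
    have "continuous_on UNIV \<gamma>" using \<gamma> by (simp add: C1_curve_def)
    then show "continuous_on I ?\<beta>"
      by (rule continuous_on_compose2) (auto intro!: continuous_intros)
    fix c t assume c: "c \<in> A" "?\<beta> t \<in> fst c" and t: "t \<in> I"
    show "(snd c \<circ> ?\<beta>) differentiable at t within I"
      using D[OF c] by (rule differentiableI_vector)
    have "isCont (\<lambda>s. velocity A UNIV \<gamma> s c) (a + t * e)"
      using \<gamma> c by (simp add: C1_curve_def)
    then have "isCont (\<lambda>s. velocity A UNIV \<gamma> (a + s * e) c) t"
      by (rule isCont_o2[rotated]) (intro continuous_intros)
    then have "((\<lambda>s. e *\<^sub>R velocity A UNIV \<gamma> (a + s * e) c) \<longlongrightarrow> e *\<^sub>R velocity A UNIV \<gamma> (a + t * e) c) (at t within I)"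
      by (intro tendsto_intros) (auto simp: isCont_def intro: tendsto_within_subset)
    moreover have "\<forall>\<^sub>F s in at t within I. e *\<^sub>R velocity A UNIV \<gamma> (a + s * e) c = velocity A I ?\<beta> s c"
      unfolding eventually_at_filter using vel by (auto simp: tscale_def)
    ultimately have "((\<lambda>s. velocity A I ?\<beta> s c) \<longlongrightarrow> e *\<^sub>R velocity A UNIV \<gamma> (a + t * e) c) (at t within I)"
      by (rule Lim_transform_eventually)
    then show "continuous (at t within I) (\<lambda>s. velocity A I ?\<beta> s c)"
      using vel[OF t] by (simp add: continuous_within tscale_def)
  qed
qed

lemma velocity_restrict:
  assumes \<gamma>: "C1_curve A UNIV \<gamma>" and nb: "\<And>t. t \<in> I \<Longrightarrow> at t within I \<noteq> bot" and t: "t \<in> I"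
  shows "velocity A I \<gamma> t = velocity A UNIV \<gamma> t"
  using velocity_affine[where a=0 and e=1, OF \<gamma> nb t] by (simp add: tscale_def)

lemma geodesic_restrict:
  assumes \<gamma>: "geodesic A g UNIV \<gamma>" and nb: "\<And>t. t \<in> I \<Longrightarrow> at t within I \<noteq> bot"
  shows "geodesic A g I \<gamma>"
proof -
  have C1: "C1_curve A UNIV \<gamma>" and par: "parallel_along A g UNIV \<gamma> (velocity A UNIV \<gamma>)"
    using \<gamma> by (auto simp: geodesic_def)
  have vel: "velocity A I \<gamma> t = velocity A UNIV \<gamma> t" if "t \<in> I" for t
    using C1 nb that by (rule velocity_restrict)
  have "parallel_along A g I \<gamma> (velocity A I \<gamma>)"
    unfolding parallel_along_def
  proof (intro ballI conjI impI)
    fix t assume t: "t \<in> I"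
    show "velocity A I \<gamma> t \<in> tangent_space A (\<gamma> t)"
      using par by (simp add: vel[OF t] parallel_along_def)
    fix c assume c: "c \<in> A" "\<gamma> t \<in> fst c"
    have "((\<lambda>s. velocity A UNIV \<gamma> s c) has_vector_derivative
        - christoffel A g c (snd c (\<gamma> t)) (velocity A UNIV \<gamma> t c) (velocity A UNIV \<gamma> t c)) (at t within I)"
      using par c by (auto simp: parallel_along_def intro: has_vector_derivative_at_within)
    then show "((\<lambda>s. velocity A I \<gamma> s c) has_vector_derivative
        - christoffel A g c (snd c (\<gamma> t)) (velocity A I \<gamma> t c) (velocity A I \<gamma> t c)) (at t within I)"
      unfolding vel[OF t] by (rule has_vector_derivative_transform[OF t, rotated]) (simp add: vel)
  qed
  moreover have "C1_curve A I \<gamma>"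
    using C1_curve_affine[where a=0 and e=1, OF C1 nb] by simp
  ultimately show ?thesis by (simp add: geodesic_def)
qed

lemma parallel_inner_constant:
  assumes C1: "C1_curve A I \<gamma>" and I: "convex I"
    and V: "parallel_along A g I \<gamma> V" and W: "parallel_along A g I \<gamma> W"
    and st: "s \<in> I" "t \<in> I"
  shows "g (\<gamma> s) (V s) (W s) = g (\<gamma> t) (V t) (W t)"
proof -
  have "((\<lambda>s. g (\<gamma> s) (V s) (W s)) has_vector_derivative 0) (at t within I)" if t: "t \<in> I" for t
  proof -
    obtain c where c: "c \<in> A" "\<gamma> t \<in> fst c" by (rule chart_exists)
    interpret mf: metric_field "snd c ` fst c" "metric_coord A g c" by (rule metric_field_coord[OF c(1)])
    have eq: "metric_coord A g c ((snd c \<circ> \<gamma>) s) (V s c) (W s c) = g (\<gamma> s) (V s) (W s)" if "s \<in> I" "\<gamma> s \<in> fst c" for s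
      using V W that c by (simp add: metric_coord_eq parallel_along_def)
    have "((\<lambda>s. metric_coord A g c ((snd c \<circ> \<gamma>) s) (V s c) (W s c)) has_vector_derivative 0) (at t within I)"
    proof (rule mf.parallel_product_deriv[OF _ C1_curve_has_velocity[OF C1 t c] t])
      show "(snd c \<circ> \<gamma>) t \<in> snd c ` fst c" using c by simp
    qed (use V W t c in \<open>auto simp: parallel_along_def christoffel_eq_chris\<close>)
    moreover have "\<forall>\<^sub>F s in at t within I. metric_coord A g c ((snd c \<circ> \<gamma>) s) (V s c) (W s c) = g (\<gamma> s) (V s) (W s)"
      using eventually_in_chart[of I \<gamma> t c] C1 t c eq
      unfolding eventually_at_filter C1_curve_def by (auto elim: eventually_mono)
    ultimately show ?thesis
      unfolding has_vector_derivative_def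
      by (rule has_derivative_transform_eventually) (use eq[OF t c(2)] t in auto)
  qed
  from has_vector_derivative_zero_constant[OF I this] st show ?thesis by metis
qed

lemma geodesic_speed_constant:
  assumes "geodesic A g I \<gamma>" "convex I" "s \<in> I" "t \<in> I"
  shows "tnorm g (\<gamma> s) (velocity A I \<gamma> s) = tnorm g (\<gamma> t) (velocity A I \<gamma> t)"
  using parallel_inner_constant[of I \<gamma> "velocity A I \<gamma>" "velocity A I \<gamma>" s t] assms
  by (simp add: geodesic_def tnorm_def)

lemma velocity_tangent:
  assumes nb: "at t within I \<noteq> bot" and cont: "continuous_on I \<gamma>" and t: "t \<in> I"
    and diff: "\<And>c. c \<in> A \<Longrightarrow> \<gamma> t \<in> fst c \<Longrightarrow> (snd c \<circ> \<gamma>) differentiable (at t within I)"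
  shows "velocity A I \<gamma> t \<in> tangent_space A (\<gamma> t)"
proof (rule tangent_spaceI)
  fix c c' assume c: "c \<in> A" "c' \<in> A" "\<gamma> t \<in> fst c" "\<gamma> t \<in> fst c'"
  have D: "((snd c \<circ> \<gamma>) has_vector_derivative velocity A I \<gamma> t c) (at t within I)"
    using diff[OF c(1,3)] c by (simp add: velocity_def vector_derivative_works)
  have "((snd c' \<circ> chart_inv c) has_derivative DT c c' (snd c (\<gamma> t))) (at ((snd c \<circ> \<gamma>) t))"
    using transition_has_derivative[OF c(1,2), of "snd c (\<gamma> t)"] c by simp
  then have "((snd c' \<circ> chart_inv c) \<circ> (snd c \<circ> \<gamma>) has_vector_derivative DT c c' (snd c (\<gamma> t)) (velocity A I \<gamma> t c))
      (at t within I)"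
    by (rule vector_derivative_diff_chain_within[OF D has_derivative_at_withinI])
  then have "((snd c' \<circ> \<gamma>) has_vector_derivative DT c c' (snd c (\<gamma> t)) (velocity A I \<gamma> t c)) (at t within I)"
    unfolding has_vector_derivative_def
    by (rule has_derivative_transform_eventually)
      (use eventually_in_chart[OF cont t c(1,3)] t c in \<open>auto simp: chart_left elim: eventually_mono\<close>)
  then show "velocity A I \<gamma> t c' = DT c c' (snd c (\<gamma> t)) (velocity A I \<gamma> t c)"
    using c vector_derivative_within[OF nb] by (simp add: velocity_def)
qed (auto simp: velocity_def)

text \<open>Away from the break points and the end points the velocity is a genuine tangent vector, so
  the integrand is nonnegative there. At the break points the velocity may be an arbitrary family
  of vectors and the integrand can be negative; these points form a null set. If the integrand is
  not integrable, the length is \<open>0\<close> by convention.\<close>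

lemma curve_length_nonneg:
  assumes "piecewise_C1_curve A \<gamma>"
  shows "0 \<le> curve_length A g \<gamma>"
proof -
  obtain S where S: "finite S" "\<And>a b. 0 \<le> a \<Longrightarrow> a < b \<Longrightarrow> b \<le> 1 \<Longrightarrow> S \<inter> {a<..<b} = {} \<Longrightarrow> C1_curve A {a..b} \<gamma>"
    and cont: "continuous_on {0..1} \<gamma>"
    using assms unfolding piecewise_C1_curve_def by blast
  let ?f = "\<lambda>t. tnorm g (\<gamma> t) (velocity A {0..1} \<gamma> t)"
  let ?N = "insert 0 (insert 1 S)"
  have nn: "0 \<le> ?f t" if t: "t \<in> {0..1} - ?N" for t
  proof -
    have "open (- ?N)" using S by (intro open_Compl finite_imp_closed) auto
    then obtain e where e: "e > 0" "ball t e \<subseteq> - ?N" using t open_contains_ball by blast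
    \<comment> \<open>An interval around \<open>t\<close> inside the unit interval that contains no break point in its
      interior.\<close>
    define d where "d = min e (min t (1 - t))"
    have d: "d > 0" "d \<le> e" "0 \<le> t - d" "t + d \<le> 1" using e t by (auto simp: d_def min_def)
    have "s \<in> ball t e" if "s \<in> {t - d<..<t + d}" for s using that d by (auto simp: dist_real_def)
    then have dS: "S \<inter> {t - d<..<t + d} = {}" using e by blast
    have C1: "C1_curve A {t - d..t + d} \<gamma>"
      using d by (intro S dS) auto
    have "velocity A {0..1} \<gamma> t \<in> tangent_space A (\<gamma> t)"
    proof (rule velocity_tangent[OF _ cont])
      show "t \<in> {0..1}" using t by simp
      then show "at t within {0..1} \<noteq> bot" by (simp add: trivial_limit_within islimpt_Icc)
      fix c assume "c \<in> A" "\<gamma> t \<in> fst c"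
      then have "(snd c \<circ> \<gamma>) differentiable (at t within {t - d..t + d})"
        using C1 d unfolding C1_curve_def by auto
      moreover have "at t within {t - d..t + d} = at t"
        using d by (intro at_within_interior) auto
      ultimately show "(snd c \<circ> \<gamma>) differentiable (at t within {0..1})"
        using differentiable_at_withinI by metis
    qed
    then show ?thesis by (rule tnorm_nonneg)
  qed
  have "integral {0..1} (\<lambda>t. if t \<in> ?N then 0 else ?f t) = integral {0..1} ?f"
    by (rule integral_spike[of ?N]) (use S in auto)
  moreover have "0 \<le> integral {0..1} (\<lambda>t. if t \<in> ?N then 0 else ?f t)"
    by (cases "(\<lambda>t. if t \<in> ?N then 0 else ?f t) integrable_on {0..1}")
      (use nn in \<open>auto intro!: Henstock_Kurzweil_Integration.integral_nonneg simp: not_integrable_integral\<close>)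
  ultimately show ?thesis by (simp add: curve_length_def)
qed

lemma geodesic_length:
  assumes "geodesic A g UNIV \<gamma>"
  shows "curve_length A g (\<lambda>r. \<gamma> (a + r * e)) = \<bar>e\<bar> * tnorm g (\<gamma> a) (velocity A UNIV \<gamma> a)"
proof -
  have C1: "C1_curve A UNIV \<gamma>" and T: "velocity A UNIV \<gamma> t \<in> tangent_space A (\<gamma> t)" for t
    using assms by (auto simp: geodesic_def parallel_along_def)
  have "tnorm g (\<gamma> (a + t * e)) (velocity A {0..1} (\<lambda>r. \<gamma> (a + r * e)) t)
      = \<bar>e\<bar> * tnorm g (\<gamma> a) (velocity A UNIV \<gamma> a)" if t: "t \<in> {0..1}" for t
  proof -
    have "velocity A {0..1} (\<lambda>r. \<gamma> (a + r * e)) t = tscale e (velocity A UNIV \<gamma> (a + t * e))"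
      by (rule velocity_affine[OF C1 _ t]) (simp add: trivial_limit_within islimpt_Icc)
    then show ?thesis
      using geodesic_speed_constant[OF assms convex_UNIV, of "a + t * e" a] by (simp add: tnorm_scale[OF T])
  qed
  then have "curve_length A g (\<lambda>r. \<gamma> (a + r * e))
      = integral {0..1} (\<lambda>t::real. \<bar>e\<bar> * tnorm g (\<gamma> a) (velocity A UNIV \<gamma> a))"
    unfolding curve_length_def by (intro integral_cong) auto
  then show ?thesis by simp
qed

text \<open>The nonnegativity of lengths is what makes the infimum defining the distance a lower bound
  of the lengths.\<close>

lemma rdist_le_geodesic:
  assumes "geodesic A g UNIV \<gamma>"
  shows "rdist A g (\<gamma> a) (\<gamma> b) \<le> \<bar>b - a\<bar> * tnorm g (\<gamma> a) (velocity A UNIV \<gamma> a)"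
proof -
  let ?\<beta> = "\<lambda>r. \<gamma> (a + r * (b - a))"
  have C1: "C1_curve A UNIV \<gamma>" using assms by (simp add: geodesic_def)
  have C1': "C1_curve A {s..t} ?\<beta>" if "s < t" for s t
    using that by (intro C1_curve_affine[OF C1]) (simp add: trivial_limit_within islimpt_Icc)
  moreover have "continuous_on {0..1} ?\<beta>" using C1'[of 0 1] by (simp add: C1_curve_def)
  ultimately have "piecewise_C1_curve A ?\<beta>"
    unfolding piecewise_C1_curve_def by (auto intro!: exI[of _ "{}"])
  then have "rdist A g (\<gamma> a) (\<gamma> b) \<le> curve_length A g ?\<beta>"
    unfolding rdist_def
    by (intro cInf_lower bdd_belowI[of _ 0]) (auto simp: curve_length_nonneg intro!: exI[of _ ?\<beta>])
  then show ?thesis using geodesic_length[OF assms, of a "b - a"] by simp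
qed

section \<open>Change of chart for the connection\<close>

abbreviation D2T :: "('a, 'e) chart \<Rightarrow> ('a, 'e) chart \<Rightarrow> 'e \<Rightarrow> 'e \<Rightarrow> 'e \<Rightarrow> 'e" where
  "D2T c c' q a b \<equiv> frechet_derivative (\<lambda>p. DT c c' p b) (at q) a"

lemma transition_second_derivative:
  assumes c: "c \<in> A" "c' \<in> A" and x: "x \<in> fst c" "x \<in> fst c'"
  shows D2T_sym: "D2T c c' (snd c x) a b = D2T c c' (snd c x) b a"
    and D2T_bilinear: "bilinear (D2T c c' (snd c x))"
proof -
  have q: "snd c x \<in> snd c ` (fst c \<inter> fst c')" using x by blast
  note D = transition_derivative_differentiable[OF c q]
  show sym: "D2T c c' (snd c x) a b = D2T c c' (snd c x) b a" for a b
    by (rule second_derivative_symmetric[OF open_overlap[OF c] q transition_has_derivative[OF c] D D])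
  have "linear (\<lambda>a. D2T c c' (snd c x) a b)" for b
    using has_derivative_linear[OF D] by (simp add: eta_contract_eq)
  moreover from this have "linear (\<lambda>b. D2T c c' (snd c x) a b)" for a
    by (subst sym)
  ultimately show "bilinear (D2T c c' (snd c x))" by (simp add: bilinear_def)
qed

text \<open>The derivative of a vector field along a curve after a change of chart: the second
  derivative of the transition map measures how the components fail to transform like a vector.\<close>

lemma DT_curve_derivative:
  assumes c: "c \<in> A" "c' \<in> A" and q: "X t \<in> snd c ` (fst c \<inter> fst c')" and t: "t \<in> S"
    and X: "(X has_vector_derivative y) (at t within S)"
    and v: "(v has_vector_derivative v') (at t within S)"
  shows "((\<lambda>s. DT c c' (X s) (v s)) has_vector_derivative D2T c c' (X t) y (v t) + DT c c' (X t) v') (at t within S)"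
proof -
  note D = transition_derivative_differentiable[OF c q]
  have lin: "linear (DT c c' p)" if "p \<in> snd c ` (fst c \<inter> fst c')" for p
    using has_derivative_linear[OF transition_has_derivative[OF c that]] .
  have "((\<lambda>s. DT c c' (X s) (v s)) has_derivative
      (\<lambda>h. D2T c c' (X t) (h *\<^sub>R y) (v t) + DT c c' (X t) (h *\<^sub>R v'))) (at t within S)"
    by (rule linear_family_has_derivative[where F="DT c c'" and X=X and F'="\<lambda>b a. D2T c c' (X t) a b", OF lin open_overlap[OF c] q])
      (use D X v t in \<open>auto simp: has_vector_derivative_def\<close>)
  then show ?thesis
    by (simp add: has_vector_derivative_def linear_scale[OF has_derivative_linear[OF D]]
        linear_scale[OF lin[OF q]] scaleR_add_right)
qed

end

locale complete_rmanifold = rmanifold +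
  assumes complete: "geodesically_complete A g"
begin

lemma geodesic_exists:
  assumes "v \<in> tangent_space A x"
  obtains \<gamma> where "geodesic A g UNIV \<gamma>" "\<gamma> 0 = x" "velocity A UNIV \<gamma> 0 = v"
  using complete assms unfolding geodesically_complete_def by blast

text \<open>Both sides are symmetric bilinear, so \<open>u = v\<close> suffices. A geodesic with initial velocity \<open>u\<close>
  satisfies the geodesic equation in both charts; differentiating the relation between the two
  coordinate velocities and comparing yields the law on the diagonal.\<close>

lemma christoffel_transition:
  assumes c: "c \<in> A" "c' \<in> A" and x: "x \<in> fst c" "x \<in> fst c'"
  shows "christoffel A g c' (snd c' x) (DT c c' (snd c x) u) (DT c c' (snd c x) v)
    = DT c c' (snd c x) (christoffel A g c (snd c x) u v) - D2T c c' (snd c x) u v"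
proof -
  let ?J = "DT c c' (snd c x)"
  interpret m1: metric_field "snd c ` fst c" "metric_coord A g c" by (rule metric_field_coord[OF c(1)])
  interpret m2: metric_field "snd c' ` fst c'" "metric_coord A g c'" by (rule metric_field_coord[OF c(2)])
  have q: "snd c x \<in> snd c ` fst c" "snd c' x \<in> snd c' ` fst c'" using x by auto
  note J = DT_linear[OF c x]
  note b1 = m1.chris_bilinear[OF q(1)] and b2 = m2.chris_bilinear[OF q(2)] and b3 = D2T_bilinear[OF c x]
  let ?B = "\<lambda>u v. christoffel A g c' (snd c' x) (?J u) (?J v)"
  let ?C = "\<lambda>u v. ?J (christoffel A g c (snd c x) u v) - D2T c c' (snd c x) u v"
  have "?B u v = ?C u v"
  proof (rule symmetric_bilinear_eqI[of ?B ?C])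
    show "bilinear ?B"
      unfolding bilinear_def christoffel_eq_chris
      by (intro conjI allI linearI) (simp_all add: linear_add[OF J] linear_scale[OF J] bilinear_ladd[OF b2]
          bilinear_radd[OF b2] bilinear_lmul[OF b2] bilinear_rmul[OF b2])
    show "bilinear ?C"
      unfolding bilinear_def christoffel_eq_chris
      by (intro conjI allI linearI) (simp_all add: linear_add[OF J] linear_scale[OF J] bilinear_ladd[OF b1]
          bilinear_radd[OF b1] bilinear_lmul[OF b1] bilinear_rmul[OF b1] bilinear_ladd[OF b3]
          bilinear_radd[OF b3] bilinear_lmul[OF b3] bilinear_rmul[OF b3] scaleR_diff_right)
    show "?B u v = ?B v u" for u v
      unfolding christoffel_eq_chris by (rule m2.chris_sym[OF q(2)])
    show "?C u v = ?C v u" for u v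
      unfolding christoffel_eq_chris by (simp only: m1.chris_sym[OF q(1), of u v] D2T_sym[OF c x, of u v])
    show "?B u u = ?C u u" for u
    proof -
      obtain \<gamma> where \<gamma>: "geodesic A g UNIV \<gamma>" "\<gamma> 0 = x" "velocity A UNIV \<gamma> 0 = tangent_of A c x u"
        using geodesic_exists[OF tangent_of_mem[OF c(1) x(1)]] by metis
      let ?y = "\<lambda>s. velocity A UNIV \<gamma> s"
      have C1: "C1_curve A UNIV \<gamma>" and par: "parallel_along A g UNIV \<gamma> ?y"
        using \<gamma>(1) by (auto simp: geodesic_def)
      have u: "?y 0 c = u" using \<gamma>(3) c x by simp
      have u': "?y 0 c' = ?J u" using \<gamma>(3) c x by (simp add: tangent_of_def)
      have d1: "((\<lambda>s. ?y s c) has_vector_derivative - christoffel A g c (snd c x) u u) (at 0)"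
        using par c x \<gamma>(2) u unfolding parallel_along_def by fastforce
      have d2: "((\<lambda>s. ?y s c') has_vector_derivative - ?B u u) (at 0)"
        using par c x \<gamma>(2) u' unfolding parallel_along_def by fastforce
      have "((\<lambda>s. DT c c' ((snd c \<circ> \<gamma>) s) (?y s c)) has_vector_derivative
          D2T c c' ((snd c \<circ> \<gamma>) 0) (?y 0 c) (?y 0 c) + DT c c' ((snd c \<circ> \<gamma>) 0) (- christoffel A g c (snd c x) u u)) (at 0)"
        by (rule DT_curve_derivative[OF c _ _ C1_curve_has_velocity[OF C1] d1]) (use c x \<gamma>(2) in auto)
      then have "((\<lambda>s. DT c c' ((snd c \<circ> \<gamma>) s) (?y s c)) has_vector_derivative
          D2T c c' (snd c x) u u + ?J (- christoffel A g c (snd c x) u u)) (at 0)"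
        using u \<gamma>(2) by simp
      then have "((\<lambda>s. DT c c' ((snd c \<circ> \<gamma>) s) (?y s c)) has_vector_derivative
          - ?C u u) (at 0)"
        by (simp add: linear_neg[OF J])
      moreover have "\<forall>\<^sub>F s in at 0. DT c c' ((snd c \<circ> \<gamma>) s) (?y s c) = ?y s c'"
      proof -
        have "\<forall>\<^sub>F s in at 0. \<gamma> s \<in> fst c \<and> \<gamma> s \<in> fst c'"
          using eventually_in_chart[of UNIV \<gamma> 0] C1 c x \<gamma>(2) by (auto simp: C1_curve_def eventually_conj_iff)
        then show ?thesis
          by (rule eventually_mono) (use par c in \<open>auto simp: parallel_along_def intro: tangent_transition[symmetric]\<close>)
      qed
      ultimately have "((\<lambda>s. ?y s c') has_vector_derivative - ?C u u) (at 0)"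
        unfolding has_vector_derivative_def
        by (rule has_derivative_transform_eventually) (use u u' \<gamma>(2) in auto)
      from vector_derivative_unique_at[OF d2 this] show ?thesis by (simp only: neg_equal_iff_equal)
    qed
  qed
  then show ?thesis .
qed

section \<open>Parallel transport along short geodesics\<close>

text \<open>The equation is solved in the chart \<open>c\<close>, where it is linear with a coefficient of norm below
  \<open>1\<close>; the solution is then transported to all other charts, in which \<open>christoffel_transition\<close>
  shows that the equation holds again.\<close>

lemma parallel_field_exists:
  assumes \<sigma>: "geodesic A g {0..1} \<sigma>" and c: "c \<in> A" and inc: "\<And>r. r \<in> {0..1} \<Longrightarrow> \<sigma> r \<in> fst c"
    and bnd: "\<And>r v. r \<in> {0..1} \<Longrightarrow>
      norm (christoffel A g c (snd c (\<sigma> r)) (velocity A {0..1} \<sigma> r c) v) \<le> \<kappa> * norm v"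
    and \<kappa>: "0 \<le> \<kappa>" "\<kappa> < 1" and w: "w \<in> tangent_space A (\<sigma> 0)"
  obtains V where "parallel_along A g {0..1} \<sigma> V" "V 0 = w"
proof -
  interpret mf: metric_field "snd c ` fst c" "metric_coord A g c" by (rule metric_field_coord[OF c])
  let ?y = "velocity A {0..1} \<sigma>"
  have C1: "C1_curve A {0..1} \<sigma>" and T: "\<And>r. r \<in> {0..1} \<Longrightarrow> ?y r \<in> tangent_space A (\<sigma> r)"
    using \<sigma> by (auto simp: geodesic_def parallel_along_def)
  have cont: "continuous_on {0..1} \<sigma>" using C1 by (simp add: C1_curve_def)
  have cS: "continuous_on {0..1} (snd c \<circ> \<sigma>)"
    by (rule continuous_on_compose[OF cont continuous_on_subset[OF chart_continuous[OF c]]]) (use inc in auto)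
  have cy: "continuous_on {0..1} (\<lambda>r. ?y r c)"
    using C1 inc c unfolding C1_curve_def continuous_on_eq_continuous_within by blast
  let ?F = "\<lambda>r v. - christoffel A g c (snd c (\<sigma> r)) (?y r c) v"
  have mem: "snd c (\<sigma> r) \<in> snd c ` fst c" if "r \<in> {0..1}" for r using inc[OF that] by blast
  have "\<exists>v. v 0 = w c \<and> (\<forall>t\<in>{0..1}. (v has_vector_derivative ?F t (v t)) (at t within {0..1}))"
  proof (rule linear_ode_exists)
    show "linear (?F t)" if "t \<in> {0..1}" for t
      using mf.chris_bilinear[OF mem[OF that]]
      by (auto simp: bilinear_def christoffel_eq_chris intro!: linear_compose_neg)
    show "norm (?F t v) \<le> \<kappa> * norm v" if "t \<in> {0..1}" for t v using bnd[OF that] by simp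
    show "continuous_on {0..1} (\<lambda>t. ?F t v)" for v
    proof (rule continuous_on_minus)
      show "continuous_on {0..1} (\<lambda>t. christoffel A g c (snd c (\<sigma> t)) (?y t c) v)"
        unfolding christoffel_eq_chris
        by (rule linear_family_continuous_on[where F="\<lambda>q u. chris (metric_coord A g c) q u v" and U="snd c ` fst c"])
          (use mf.chris_bilinear mf.chris_continuous cS cy mem in \<open>auto simp: bilinear_def o_def\<close>)
    qed
  qed (use \<kappa> in auto)
  then obtain v where v: "v 0 = w c" "\<And>t. t \<in> {0..1} \<Longrightarrow> (v has_vector_derivative ?F t (v t)) (at t within {0..1})"
    by blast
  define V where "V t = tangent_of A c (\<sigma> t) (v t)" for t
  have V: "V t \<in> tangent_space A (\<sigma> t)" "V t c = v t" if "t \<in> {0..1}" for t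
    using inc[OF that] c by (auto simp: V_def tangent_of_mem)
  have "parallel_along A g {0..1} \<sigma> V"
    unfolding parallel_along_def
  proof (intro ballI conjI impI)
    fix t :: real assume t: "t \<in> {0..1}"
    show "V t \<in> tangent_space A (\<sigma> t)" using V t by blast
    fix c' assume c': "c' \<in> A" "\<sigma> t \<in> fst c'"
    note x = inc[OF t] c'(2)
    let ?J = "DT c c' (snd c (\<sigma> t))"
    have d: "((\<lambda>s. DT c c' ((snd c \<circ> \<sigma>) s) (v s)) has_vector_derivative
        D2T c c' ((snd c \<circ> \<sigma>) t) (?y t c) (v t) + DT c c' ((snd c \<circ> \<sigma>) t) (?F t (v t))) (at t within {0..1})"
      by (rule DT_curve_derivative[OF c c'(1) _ t C1_curve_has_velocity[OF C1 t c] v(2)[OF t]])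
        (use x t in auto)
    have e: "D2T c c' ((snd c \<circ> \<sigma>) t) (?y t c) (v t) + DT c c' ((snd c \<circ> \<sigma>) t) (?F t (v t))
        = - christoffel A g c' (snd c' (\<sigma> t)) (?y t c') (V t c')"
    proof -
      have "?y t c' = ?J (?y t c)" "V t c' = ?J (v t)"
        using tangent_transition[OF T[OF t] c c'(1) x] tangent_transition[OF V(1)[OF t] c c'(1) x] V(2)[OF t] by simp_all
      then show ?thesis
        by (simp add: christoffel_transition[OF c c'(1) x] linear_neg[OF DT_linear[OF c c'(1) x]])
    qed
    have ev: "\<forall>\<^sub>F s in at t within {0..1}. DT c c' ((snd c \<circ> \<sigma>) s) (v s) = V s c'"
      using eventually_in_chart[OF cont t c'] unfolding eventually_at_filter
    proof (rule eventually_mono, intro impI)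
      fix s assume "s \<noteq> t \<longrightarrow> s \<in> {0..1} \<longrightarrow> \<sigma> s \<in> fst c'" "s \<noteq> t" and s: "s \<in> {0..1}"
      then show "DT c c' ((snd c \<circ> \<sigma>) s) (v s) = V s c'"
        using tangent_transition[OF V(1)[OF s] c c'(1) inc[OF s]] V(2)[OF s] by simp
    qed
    show "((\<lambda>s. V s c') has_vector_derivative
        - christoffel A g c' (snd c' (\<sigma> t)) (?y t c') (V t c')) (at t within {0..1})"
      using d unfolding e has_vector_derivative_def
      by (rule has_derivative_transform_eventually[OF _ ev])
         (use tangent_transition[OF V(1)[OF t] c c'(1) x] V(2)[OF t] t in auto)
  qed
  moreover have "V 0 = w" using w v inc[of 0] c by (simp add: V_def tangent_of_coord)
  ultimately show thesis by (rule that)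
qed

text \<open>Both estimates hold at \<open>p\<close> by finite dimension and persist nearby by continuity.\<close>

lemma chart_constants:
  assumes c: "c \<in> A" and p: "p \<in> fst c"
  obtains \<rho> C M where "\<rho> > 0" "C > 0" "M > 0" "cball (snd c p) \<rho> \<subseteq> snd c ` fst c"
    "\<And>q w. q \<in> cball (snd c p) \<rho> \<Longrightarrow> norm w \<le> C * sqrt (metric_coord A g c q w w)"
    "\<And>q u v. q \<in> cball (snd c p) \<rho> \<Longrightarrow> norm (christoffel A g c q u v) \<le> M * norm u * norm v"
proof -
  interpret mf: metric_field "snd c ` fst c" "metric_coord A g c" by (rule metric_field_coord[OF c])
  let ?P = "snd c p"
  have P: "?P \<in> snd c ` fst c" using p by blast
  obtain k where k: "k > 0"
    "\<forall>\<^sub>F q in nhds ?P. q \<in> snd c ` fst c \<and> (\<forall>w. k * (norm w)\<^sup>2 \<le> metric_coord A g c q w w)"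
    using mf.uniformly_positive[OF P] by blast
  obtain B where B: "B > 0" "\<And>u v. norm (christoffel A g c ?P u v) \<le> B * norm u * norm v"
    using bilinear_bounded_pos[OF mf.chris_bilinear[OF P]] unfolding christoffel_eq_chris by blast
  have "\<forall>\<^sub>F q in nhds ?P. q \<in> snd c ` fst c \<and>
      (\<forall>u v. norm (christoffel A g c q u v - christoffel A g c ?P u v) \<le> 1 * norm u * norm v)"
    unfolding christoffel_eq_chris
    by (rule bilinear_family_close[OF mf.chris_bilinear mf.open_U P mf.chris_continuous]) auto
  with k(2) have "\<forall>\<^sub>F q in nhds ?P. (q \<in> snd c ` fst c \<and> (\<forall>w. k * (norm w)\<^sup>2 \<le> metric_coord A g c q w w)) \<and>
      (\<forall>u v. norm (christoffel A g c q u v - christoffel A g c ?P u v) \<le> 1 * norm u * norm v)"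
    by eventually_elim blast
  then obtain e where e: "e > 0" "\<And>q. dist q ?P < e \<Longrightarrow> (q \<in> snd c ` fst c \<and> (\<forall>w. k * (norm w)\<^sup>2 \<le> metric_coord A g c q w w)) \<and>
      (\<forall>u v. norm (christoffel A g c q u v - christoffel A g c ?P u v) \<le> 1 * norm u * norm v)"
    unfolding eventually_nhds_metric by blast
  have e': "dist q ?P < e" if "q \<in> cball ?P (e/2)" for q
    using that e(1) by (simp add: dist_commute)
  show thesis
  proof (rule that[of "e/2" "1 / sqrt k" "B + 1"])
    show "cball ?P (e/2) \<subseteq> snd c ` fst c" using e(2) e' by blast
    fix q assume q: "q \<in> cball ?P (e/2)"
    show "norm w \<le> 1 / sqrt k * sqrt (metric_coord A g c q w w)" for w
    proof -
      have "sqrt (k * (norm w)\<^sup>2) \<le> sqrt (metric_coord A g c q w w)"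
        using e(2)[OF e'[OF q]] by (intro real_sqrt_le_mono) blast
      then show ?thesis using k(1) by (simp add: real_sqrt_mult field_simps)
    qed
    show "norm (christoffel A g c q u v) \<le> (B + 1) * norm u * norm v" for u v
    proof -
      have "norm (christoffel A g c q u v) \<le> norm (christoffel A g c ?P u v) + norm (christoffel A g c q u v - christoffel A g c ?P u v)"
        by (metis norm_triangle_sub)
      also have "\<dots> \<le> B * norm u * norm v + 1 * norm u * norm v"
        using B(2)[of u v] e(2)[OF e'[OF q]] by (intro add_mono) blast+
      finally show ?thesis by (simp add: algebra_simps)
    qed
  qed (use e k B in auto)
qed

text \<open>As long as the geodesic stays in the coordinate ball, its coordinate speed is at most \<open>C l\<close>,
  since its Riemannian speed is constantly \<open>l\<close>. At a first exit time it would therefore still lie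
  in the closed ball of radius \<open>C l < \<rho>\<close>, a contradiction. Compactness of that ball makes its
  preimage closed in the manifold, which excludes that the curve leaves through the boundary of
  the chart domain.\<close>

lemma short_geodesic_in_chart:
  assumes c: "c \<in> A" and p: "p \<in> fst c" and C: "C > 0"
    and ball: "cball (snd c p) \<rho> \<subseteq> snd c ` fst c"
    and low: "\<And>q w. q \<in> cball (snd c p) \<rho> \<Longrightarrow> norm w \<le> C * sqrt (metric_coord A g c q w w)"
    and \<sigma>: "geodesic A g UNIV \<sigma>" "\<sigma> 0 = p" and l: "tnorm g p (velocity A UNIV \<sigma> 0) = l" "C * l < \<rho>"
    and r: "r \<in> {0..1}"
  shows "\<sigma> r \<in> fst c" "norm (snd c (\<sigma> r) - snd c p) \<le> C * l" "norm (velocity A UNIV \<sigma> r c) \<le> C * l"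
proof -
  let ?P = "snd c p"
  have C1: "C1_curve A UNIV \<sigma>" and T: "\<And>r. velocity A UNIV \<sigma> r \<in> tangent_space A (\<sigma> r)"
    using \<sigma> by (auto simp: geodesic_def parallel_along_def)
  have cont: "continuous_on UNIV \<sigma>" using C1 by (simp add: C1_curve_def)
  have l0: "0 \<le> l" using tnorm_nonneg[OF T[of 0]] l \<sigma> by simp
  define O' where "O' = fst c \<inter> snd c -` ball ?P \<rho>"
  have O': "open O'"
    unfolding O'_def using continuous_open_preimage[OF chart_continuous open_domain open_ball] c by blast
  define K where "K = chart_inv c ` cball ?P (C * l)"
  have "compact K"
    unfolding K_def
    by (rule compact_continuous_image[OF continuous_on_subset[OF chart_inv_continuous[OF c]] compact_cball])
      (use ball l in \<open>auto simp: subset_iff\<close>)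
  then have K: "closed K" by (rule compact_imp_closed)
  have KO: "K \<subseteq> O'"
  proof
    fix y assume "y \<in> K"
    then obtain q where q: "q \<in> cball ?P (C * l)" "y = chart_inv c q" unfolding K_def by blast
    then have "q \<in> snd c ` fst c" using ball l by (auto simp: subset_iff)
    then show "y \<in> O'"
      using q l chart_right[OF c] chart_inv_mem[OF c] by (auto simp: O'_def)
  qed
  have speed: "norm (velocity A UNIV \<sigma> r c) \<le> C * l" if "\<sigma> r \<in> O'" for r
  proof -
    have "\<sigma> r \<in> fst c" "snd c (\<sigma> r) \<in> cball ?P \<rho>" using that by (auto simp: O'_def)
    then have "norm (velocity A UNIV \<sigma> r c) \<le> C * tnorm g (\<sigma> r) (velocity A UNIV \<sigma> r)"
      using low c by (simp add: tnorm_coord[OF c _ T])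
    then show ?thesis
      using geodesic_speed_constant[OF \<sigma>(1), of r 0] l \<sigma> by simp
  qed
  have near: "norm (snd c (\<sigma> r) - ?P) \<le> C * l" if r: "0 \<le> r" "r \<le> 1" and O: "\<And>s. s \<in> {0..r} \<Longrightarrow> \<sigma> s \<in> O'" for r
  proof -
    have "norm ((snd c \<circ> \<sigma>) r - (snd c \<circ> \<sigma>) 0) \<le> (C * l) * (r - 0)"
    proof (rule vector_derivative_bound)
      fix s assume s: "s \<in> {0..r}"
      show "((snd c \<circ> \<sigma>) has_vector_derivative velocity A UNIV \<sigma> s c) (at s within {0..r})"
        using C1_curve_has_velocity[OF C1 _ c, of s] O[OF s]
        by (auto simp: O'_def intro: has_vector_derivative_at_within)
      show "norm (velocity A UNIV \<sigma> s c) \<le> C * l" by (rule speed[OF O[OF s]])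
    qed (use r in auto)
    also have "\<dots> \<le> C * l" using r l0 C by (simp add: mult_left_le)
    finally show ?thesis using \<sigma> by simp
  qed
  have inO: "\<sigma> r \<in> O'" if r: "r \<in> {0..1}" for r
  proof (rule ccontr)
    assume neg: "\<sigma> r \<notin> O'"
    define E where "E = {s \<in> {0..1}. \<sigma> s \<notin> O'}"
    have "E = {0..1} \<inter> \<sigma> -` (- O')" by (auto simp: E_def)
    then have "closed E"
      using continuous_closed_preimage[OF continuous_on_subset[OF cont], of "{0..1}" "- O'"] O' by auto
    moreover have "E \<noteq> {}" "bdd_below E" using neg r by (auto simp: E_def bdd_below_def)
    ultimately have i: "Inf E \<in> E" and lb: "\<And>s. s \<in> E \<Longrightarrow> Inf E \<le> s"
      by (auto intro: closed_contains_Inf cInf_lower)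
    define i where "i = Inf E"
    have i01: "0 \<le> i" "i \<le> 1" and iO: "\<sigma> i \<notin> O'" using i by (auto simp: E_def i_def)
    have before: "\<sigma> s \<in> O'" if "0 \<le> s" "s < i" for s
      using lb[of s] that i01 by (force simp: E_def i_def)
    have "?P \<in> ball ?P \<rho>"
      using l(2) mult_nonneg_nonneg[OF less_imp_le[OF C] l0] by simp
    then have "\<sigma> 0 \<in> O'" using \<sigma> p by (simp add: O'_def)
    then have "0 < i" using iO i01 by (cases "i = 0") auto
    have sub: "{0..<i} \<subseteq> \<sigma> -` K"
    proof
      fix s assume s: "s \<in> {0..<i}"
      have "norm (snd c (\<sigma> s) - ?P) \<le> C * l"
        by (rule near) (use s i01 before in auto)
      then have "snd c (\<sigma> s) \<in> cball ?P (C * l)" by (simp add: dist_norm norm_minus_commute)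
      moreover have "\<sigma> s \<in> fst c" using before[of s] s by (auto simp: O'_def)
      ultimately show "s \<in> \<sigma> -` K" unfolding K_def using chart_left[OF c, of "\<sigma> s"] by force
    qed
    moreover have "closed (\<sigma> -` K)" using continuous_closed_vimage[OF K] cont continuous_on_eq_continuous_at by blast
    ultimately have "closure {0..<i} \<subseteq> \<sigma> -` K" by (rule closure_minimal)
    moreover have "i \<in> closure {0..<i}" using \<open>0 < i\<close> by (simp add: closure_atLeastLessThan)
    ultimately have "\<sigma> i \<in> K" by blast
    then show False using KO iO by blast
  qed
  show "\<sigma> r \<in> fst c" using inO[OF r] by (simp add: O'_def)
  show "norm (velocity A UNIV \<sigma> r c) \<le> C * l" by (rule speed[OF inO[OF r]])
  show "norm (snd c (\<sigma> r) - ?P) \<le> C * l" by (rule near) (use inO r in auto)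
qed

text \<open>First-order expansion of parallel transport along a short geodesic of length \<open>l\<close>: in the
  transport equation the base point may be frozen at \<open>p\<close> and the field at \<open>w\<close>, at the cost of an
  error of smaller order than \<open>l\<close>. The equation then integrates to the displacement of the end
  points, so the leading term depends on the geodesic only through its end point. The field stays
  bounded because parallel fields have constant Riemannian norm.\<close>

lemma infinitesimal_transport:
  assumes c: "c \<in> A" and p: "p \<in> fst c" and w: "w \<in> tangent_space A p" and \<epsilon>: "\<epsilon> > 0"
  obtains \<delta> where "\<delta> > 0"
    "\<And>\<sigma>. geodesic A g UNIV \<sigma> \<Longrightarrow> \<sigma> 0 = p \<Longrightarrow> tnorm g p (velocity A UNIV \<sigma> 0) < \<delta> \<Longrightarrow>
       parallel_transport A g \<sigma> w \<in> tangent_space A (\<sigma> 1) \<and>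
       norm (parallel_transport A g \<sigma> w c - w c + christoffel A g c (snd c p) (snd c (\<sigma> 1) - snd c p) (w c))
         \<le> \<epsilon> * tnorm g p (velocity A UNIV \<sigma> 0)"
proof -
  let ?P = "snd c p" and ?\<Gamma> = "christoffel A g c"
  obtain \<rho> C M where \<rho>: "\<rho> > 0" and C: "C > 0" and M: "M > 0"
    and ball: "cball ?P \<rho> \<subseteq> snd c ` fst c"
    and low: "\<And>q w. q \<in> cball ?P \<rho> \<Longrightarrow> norm w \<le> C * sqrt (metric_coord A g c q w w)"
    and bnd: "\<And>q u v. q \<in> cball ?P \<rho> \<Longrightarrow> norm (?\<Gamma> q u v) \<le> M * norm u * norm v"
    using chart_constants[OF c p] by metis
  interpret mf: metric_field "snd c ` fst c" "metric_coord A g c" by (rule metric_field_coord[OF c])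
  have P: "?P \<in> snd c ` fst c" using p by blast
  have bil: "bilinear (?\<Gamma> q)" if "q \<in> snd c ` fst c" for q
    using mf.chris_bilinear[OF that] by (simp add: christoffel_eq_chris)
  \<comment> \<open>A bound for the coordinate norm of a field that is parallel with initial value \<open>w\<close>.\<close>
  define N where "N = C * tnorm g p w"
  have N: "0 \<le> N" using C tnorm_nonneg[OF w] by (simp add: N_def)
  \<comment> \<open>The error budget: half of \<open>\<epsilon>\<close> for moving the base point of \<open>\<Gamma>\<close>, half for the change of the
    field. The summand \<open>1\<close> here and in \<open>Q\<close> keeps the denominators positive when \<open>w = 0\<close>.\<close>
  define e where "e = \<epsilon> / (2 * (C * N + 1))"
  have CN: "0 < C * N + 1" using C N by (simp add: add_nonneg_pos)
  have e: "e > 0" and eCN: "e * (C * N) \<le> \<epsilon> / 2"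
  proof -
    show e: "e > 0" using CN \<epsilon> by (simp add: e_def)
    have "e * (C * N) \<le> e * (C * N + 1)" using e by simp
    also have "\<dots> = \<epsilon> / 2" using less_imp_neq[OF CN] unfolding e_def by (simp add: divide_simps)
    finally show "e * (C * N) \<le> \<epsilon> / 2" .
  qed
  have "\<forall>\<^sub>F q in nhds ?P. q \<in> snd c ` fst c \<and> (\<forall>u v. norm (?\<Gamma> q u v - ?\<Gamma> ?P u v) \<le> e * norm u * norm v)"
    unfolding christoffel_eq_chris
    by (rule bilinear_family_close[OF mf.chris_bilinear mf.open_U P mf.chris_continuous e])
  then obtain \<rho>' where \<rho>': "\<rho>' > 0"
    "\<And>q u v. dist q ?P < \<rho>' \<Longrightarrow> norm (?\<Gamma> q u v - ?\<Gamma> ?P u v) \<le> e * norm u * norm v"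
    unfolding eventually_nhds_metric by blast
  define Q where "Q = M * C * (M * C * N) + 1"
  have Q: "Q > 0" using M C N by (simp add: Q_def add_nonneg_pos)
  \<comment> \<open>In this order, the four bounds keep the geodesic in the ball where the constants hold, keep
    it where \<open>\<Gamma>\<close> is close to its value at \<open>p\<close>, make the Picard operator a contraction, and keep
    the second half of the error within its budget.\<close>
  define \<delta> where "\<delta> = min (min (\<rho> / C) (\<rho>' / C)) (min (1 / (M * C)) (\<epsilon> / (2 * Q)))"
  have \<delta>: "\<delta> > 0" using \<rho> C \<rho>' M \<epsilon> Q by (simp add: \<delta>_def)
  show thesis
  proof (rule that[OF \<delta>])
    fix \<sigma> assume \<sigma>: "geodesic A g UNIV \<sigma>" "\<sigma> 0 = p" and small: "tnorm g p (velocity A UNIV \<sigma> 0) < \<delta>"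
    define l where "l = tnorm g p (velocity A UNIV \<sigma> 0)"
    have C1: "C1_curve A UNIV \<sigma>" and T: "\<And>r. velocity A UNIV \<sigma> r \<in> tangent_space A (\<sigma> r)"
      using \<sigma> by (auto simp: geodesic_def parallel_along_def)
    have l0: "0 \<le> l" using tnorm_nonneg[OF T[of 0]] \<sigma> by (simp add: l_def)
    have l: "C * l < \<rho>" "C * l < \<rho>'" "M * C * l < 1" "l * Q \<le> \<epsilon> / 2"
      using small C M Q by (simp_all add: l_def[symmetric] \<delta>_def field_simps)
    have short: "\<sigma> r \<in> fst c" "norm (snd c (\<sigma> r) - ?P) \<le> C * l" "norm (velocity A UNIV \<sigma> r c) \<le> C * l"
      if "r \<in> {0..1}" for r
      using short_geodesic_in_chart[OF c p C ball _ \<sigma> l_def[symmetric] l(1) that] low by blast+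
    let ?y = "velocity A {0..1} \<sigma>" and ?S = "\<lambda>r. snd c (\<sigma> r)"
    have nb: "at r within {0..1} \<noteq> bot" if "r \<in> {0..1}" for r :: real
      using that by (simp add: trivial_limit_within islimpt_Icc)
    have y: "?y r = velocity A UNIV \<sigma> r" if "r \<in> {0..1}" for r
      using velocity_restrict[OF C1 nb that] .
    have geo: "geodesic A g {0..1} \<sigma>" using geodesic_restrict[OF \<sigma>(1) nb] .
    have C1': "C1_curve A {0..1} \<sigma>" using geo by (simp add: geodesic_def)
    have Sb: "?S r \<in> cball ?P \<rho>" "dist (?S r) ?P < \<rho>'" "norm (?y r c) \<le> C * l" if "r \<in> {0..1}" for r
      using short(2,3)[OF that] l y[OF that] by (simp_all add: dist_norm norm_minus_commute)
    have \<Gamma>b: "norm (?\<Gamma> (?S r) (?y r c) v) \<le> (M * C * l) * norm v" if "r \<in> {0..1}" for r v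
    proof -
      have "norm (?\<Gamma> (?S r) (?y r c) v) \<le> M * norm (?y r c) * norm v" using bnd Sb(1)[OF that] by blast
      also have "\<dots> \<le> M * (C * l) * norm v"
        using Sb(3)[OF that] M by (intro mult_right_mono mult_left_mono) auto
      finally show ?thesis by (simp add: mult.assoc)
    qed
    obtain V0 where "parallel_along A g {0..1} \<sigma> V0" "V0 0 = w"
      using parallel_field_exists[OF geo c short(1) \<Gamma>b _ l(3), of w] w \<sigma> M C l0 by auto
    then have "\<exists>v. \<exists>V. parallel_along A g {0..1} \<sigma> V \<and> V 0 = w \<and> V 1 = v" by blast
    then have "\<exists>V. parallel_along A g {0..1} \<sigma> V \<and> V 0 = w \<and> V 1 = parallel_transport A g \<sigma> w"
      unfolding parallel_transport_def by (rule someI_ex)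
    then obtain V where V: "parallel_along A g {0..1} \<sigma> V" "V 0 = w" and V1: "parallel_transport A g \<sigma> w = V 1"
      by metis
    have VT: "V r \<in> tangent_space A (\<sigma> r)" if "r \<in> {0..1}" for r
      using V that by (simp add: parallel_along_def)
    have V': "((\<lambda>s. V s c) has_vector_derivative - ?\<Gamma> (?S r) (?y r c) (V r c)) (at r within {0..1})" if "r \<in> {0..1}" for r
      using V that c short(1)[OF that] by (simp add: parallel_along_def)
    have VN: "norm (V r c) \<le> N" if r: "r \<in> {0..1}" for r
    proof -
      have "norm (V r c) \<le> C * tnorm g (\<sigma> r) (V r)"
        using low[OF Sb(1)[OF r]] by (simp add: tnorm_coord[OF c short(1)[OF r] VT[OF r]])
      also have "tnorm g (\<sigma> r) (V r) = tnorm g p w"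
        using parallel_inner_constant[OF C1' convex_closed_interval V(1) V(1) r, of 0] V \<sigma> by (simp add: tnorm_def)
      finally show ?thesis by (simp add: N_def)
    qed
    have Vw: "norm (V r c - w c) \<le> M * C * l * N" if r: "r \<in> {0..1}" for r
    proof -
      have "norm (V r c - V 0 c) \<le> (M * C * l * N) * (r - 0)"
      proof (rule vector_derivative_bound)
        fix s assume s: "s \<in> {0..r}"
        then have s1: "s \<in> {0..1}" using r by auto
        show "((\<lambda>s. V s c) has_vector_derivative - ?\<Gamma> (?S s) (?y s c) (V s c)) (at s within {0..r})"
          by (rule has_vector_derivative_within_subset[OF V'[OF s1]]) (use r in auto)
        have "norm (?\<Gamma> (?S s) (?y s c) (V s c)) \<le> M * C * l * norm (V s c)" by (rule \<Gamma>b[OF s1])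
        also have "\<dots> \<le> M * C * l * N" using VN[OF s1] M C l0 by (intro mult_left_mono) auto
        finally show "norm (- ?\<Gamma> (?S s) (?y s c) (V s c)) \<le> M * C * l * N" by simp
      qed (use r in auto)
      also have "\<dots> \<le> M * C * l * N" using r M C l0 N by (simp add: mult_left_le)
      finally show ?thesis using V by simp
    qed
    \<comment> \<open>The error of the expansion at time \<open>r\<close>; it starts at \<open>0\<close>, and its derivative is at most
      \<open>\<epsilon> l\<close> in norm.\<close>
    define k where "k r = V r c - w c + ?\<Gamma> ?P (?S r - ?P) (w c)" for r
    have linP: "linear (\<lambda>u. ?\<Gamma> ?P u (w c))" using bil[OF P] by (simp add: bilinear_def)
    have "norm (k 1 - k 0) \<le> (\<epsilon> * l) * (1 - 0)"
    proof (rule vector_derivative_bound)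
      fix r :: real assume r: "r \<in> {0..1}"
      have "((snd c \<circ> \<sigma>) has_vector_derivative ?y r c) (at r within {0..1})"
        by (rule C1_curve_has_velocity[OF C1' r c short(1)[OF r]])
      then have "((\<lambda>r. ?S r - ?P) has_vector_derivative ?y r c) (at r within {0..1})"
        by (auto simp: o_def intro!: derivative_eq_intros)
      then have "((\<lambda>r. ?\<Gamma> ?P (?S r - ?P) (w c)) has_vector_derivative ?\<Gamma> ?P (?y r c) (w c)) (at r within {0..1})"
        by (rule bounded_linear.has_vector_derivative[OF linP[unfolded linear_conv_bounded_linear]])
      then show "(k has_vector_derivative - ?\<Gamma> (?S r) (?y r c) (V r c) + ?\<Gamma> ?P (?y r c) (w c)) (at r within {0..1})"
        unfolding k_def by (auto intro!: derivative_eq_intros V'[OF r])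
      have "norm (?\<Gamma> (?S r) (?y r c) (V r c) - ?\<Gamma> ?P (?y r c) (V r c)) \<le> e * norm (?y r c) * norm (V r c)"
        by (rule \<rho>'(2)[OF Sb(2)[OF r]])
      also have "\<dots> \<le> e * (C * l) * N"
        using Sb(3)[OF r] VN[OF r] e C l0 by (intro mult_mono mult_left_mono) auto
      also have "\<dots> = (e * (C * N)) * l" by simp
      also have "\<dots> \<le> \<epsilon> / 2 * l" using eCN l0 by (intro mult_right_mono)
      finally have 1: "norm (?\<Gamma> (?S r) (?y r c) (V r c) - ?\<Gamma> ?P (?y r c) (V r c)) \<le> \<epsilon> / 2 * l" .
      have "norm (?\<Gamma> ?P (?y r c) (V r c - w c)) \<le> M * norm (?y r c) * norm (V r c - w c)"
        using bnd[of ?P] \<rho> by simp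
      also have "\<dots> \<le> M * (C * l) * (M * C * l * N)"
        using Sb(3)[OF r] Vw[OF r] M C l0 by (intro mult_mono mult_left_mono) auto
      also have "\<dots> = l * (l * (M * C * (M * C * N)))" by (simp add: algebra_simps)
      also have "\<dots> \<le> l * (l * Q)" using l0 by (intro mult_left_mono) (auto simp: Q_def)
      also have "\<dots> \<le> l * (\<epsilon> / 2)" using l l0 by (intro mult_left_mono)
      finally have 2: "norm (?\<Gamma> ?P (?y r c) (V r c - w c)) \<le> \<epsilon> / 2 * l" by (simp add: mult.commute)
      have "- ?\<Gamma> (?S r) (?y r c) (V r c) + ?\<Gamma> ?P (?y r c) (w c)
          = - ((?\<Gamma> (?S r) (?y r c) (V r c) - ?\<Gamma> ?P (?y r c) (V r c)) + ?\<Gamma> ?P (?y r c) (V r c - w c))"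
        by (simp add: bilinear_rsub[OF bil[OF P]])
      then have "norm (- ?\<Gamma> (?S r) (?y r c) (V r c) + ?\<Gamma> ?P (?y r c) (w c))
          \<le> norm (?\<Gamma> (?S r) (?y r c) (V r c) - ?\<Gamma> ?P (?y r c) (V r c)) + norm (?\<Gamma> ?P (?y r c) (V r c - w c))"
        by (simp only: norm_minus_cancel norm_triangle_ineq)
      also have "\<dots> \<le> \<epsilon> * l" using 1 2 by simp
      finally show "norm (- ?\<Gamma> (?S r) (?y r c) (V r c) + ?\<Gamma> ?P (?y r c) (w c)) \<le> \<epsilon> * l" .
    qed simp
    moreover have "k 0 = 0" using V \<sigma> bilinear_lzero[OF bil[OF P]] by (simp add: k_def)
    ultimately have "norm (k 1) \<le> \<epsilon> * l" by simp
    then show "parallel_transport A g \<sigma> w \<in> tangent_space A (\<sigma> 1) \<and>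
       norm (parallel_transport A g \<sigma> w c - w c + ?\<Gamma> ?P (snd c (\<sigma> 1) - ?P) (w c)) \<le> \<epsilon> * tnorm g p (velocity A UNIV \<sigma> 0)"
      using V1 VT[of 1] by (simp add: k_def l_def)
  qed
qed

section \<open>Descent along geodesics\<close>

lemma exp_map_geodesic:
  assumes "v \<in> tangent_space A x"
  obtains \<gamma> where "geodesic A g UNIV \<gamma>" "\<gamma> 0 = x" "velocity A UNIV \<gamma> 0 = v" "\<gamma> 1 = exp_map A g x v"
proof -
  have "\<exists>\<gamma>. geodesic A g UNIV \<gamma> \<and> \<gamma> 0 = x \<and> velocity A UNIV \<gamma> 0 = v"
    using geodesic_exists[OF assms] by metis
  from someI_ex[OF this] show thesis by (intro that) (auto simp: exp_map_def)
qed

text \<open>A logarithm is the initial velocity of a geodesic of constant speed \<open>d(x, y)\<close>, whose length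
  on the unit interval is hence \<open>d(x, y)\<close>.\<close>

lemma minimising_geodesic_exists:
  assumes "logarithmic_map A g lg"
  obtains \<sigma> where "geodesic A g UNIV \<sigma>" "\<sigma> 0 = x" "\<sigma> 1 = y" "tnorm g x (velocity A UNIV \<sigma> 0) = rdist A g x y"
    "minimising_geodesic A g x y \<sigma>"
proof -
  have lg: "lg x y \<in> tangent_space A x" "exp_map A g x (lg x y) = y" "tnorm g x (lg x y) = rdist A g x y"
    using assms by (auto simp: logarithmic_map_def)
  obtain \<sigma> where \<sigma>: "geodesic A g UNIV \<sigma>" "\<sigma> 0 = x" "velocity A UNIV \<sigma> 0 = lg x y" "\<sigma> 1 = y"
    using exp_map_geodesic[OF lg(1)] lg(2) by metis
  have "geodesic A g {0..1} \<sigma>"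
    by (rule geodesic_restrict[OF \<sigma>(1)]) (simp add: trivial_limit_within islimpt_Icc)
  moreover have "curve_length A g \<sigma> = rdist A g x y"
    using geodesic_length[OF \<sigma>(1), of 0 1] \<sigma> lg by simp
  ultimately have "minimising_geodesic A g x y \<sigma>"
    using \<sigma> by (simp add: minimising_geodesic_def)
  then show thesis using that \<sigma> lg by metis
qed

lemma slope_along_geodesic:
  assumes f: "C1_function A f" and \<gamma>: "geodesic A g UNIV \<gamma>"
  shows "((\<lambda>t. f (\<gamma> t)) has_real_derivative g (\<gamma> t) (grad A g f (\<gamma> t)) (velocity A UNIV \<gamma> t)) (at t)"
proof -
  obtain c where c: "c \<in> A" "\<gamma> t \<in> fst c" by (rule chart_exists)
  have C1: "C1_curve A UNIV \<gamma>" and T: "velocity A UNIV \<gamma> t \<in> tangent_space A (\<gamma> t)"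
    using \<gamma> by (auto simp: geodesic_def parallel_along_def)
  have "((f \<circ> chart_inv c) has_derivative frechet_derivative (f \<circ> chart_inv c) (at (snd c (\<gamma> t))))
      (at ((snd c \<circ> \<gamma>) t))"
    using C1_function_has_derivative[OF f c] by simp
  then have "((f \<circ> chart_inv c) \<circ> (snd c \<circ> \<gamma>) has_vector_derivative
      frechet_derivative (f \<circ> chart_inv c) (at (snd c (\<gamma> t))) (velocity A UNIV \<gamma> t c)) (at t)"
    by (rule vector_derivative_diff_chain_within[OF C1_curve_has_velocity[OF C1 UNIV_I c] has_derivative_at_withinI])
  then have "((f \<circ> chart_inv c) \<circ> (snd c \<circ> \<gamma>) has_vector_derivative
      g (\<gamma> t) (grad A g f (\<gamma> t)) (velocity A UNIV \<gamma> t)) (at t)"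
    by (simp only: gradient(2)[OF f c T])
  moreover have "\<forall>\<^sub>F s in at t. ((f \<circ> chart_inv c) \<circ> (snd c \<circ> \<gamma>)) s = f (\<gamma> s)"
    using eventually_in_chart[of UNIV \<gamma> t c] C1 c by (auto simp: C1_curve_def chart_left elim: eventually_mono)
  ultimately have "((\<lambda>t. f (\<gamma> t)) has_vector_derivative g (\<gamma> t) (grad A g f (\<gamma> t)) (velocity A UNIV \<gamma> t)) (at t)"
    unfolding has_vector_derivative_def
    by (elim has_derivative_transform_eventually) (use c in \<open>auto simp: chart_left\<close>)
  then show ?thesis by (simp add: has_real_derivative_iff_has_vector_derivative)
qed

text \<open>By \<open>infinitesimal_transport\<close> the end values \<open>W s\<close> of the transports of \<open>w\<close> along the varying
  geodesics \<open>\<sigma> s\<close> have, in a chart, the same derivative at \<open>t\<close> as a field that is parallel along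
  \<open>\<gamma>\<close>. Its product with the parallel field \<open>\<gamma>'\<close> is thus stationary at \<open>t\<close>.\<close>

lemma transported_product_stationary:
  assumes w: "w \<in> tangent_space A (\<gamma> t)" and \<gamma>: "geodesic A g UNIV \<gamma>"
    and \<sigma>: "\<And>s. geodesic A g UNIV (\<sigma> s)" "\<And>s. \<sigma> s 0 = \<gamma> t" "\<And>s. \<sigma> s 1 = \<gamma> s"
      "\<And>s. tnorm g (\<gamma> t) (velocity A UNIV (\<sigma> s) 0) = rdist A g (\<gamma> t) (\<gamma> s)"
    and \<epsilon>: "\<epsilon> > 0"
  obtains d where "d > 0"
    "\<And>s. \<bar>s - t\<bar> < d \<Longrightarrow> parallel_transport A g (\<sigma> s) w \<in> tangent_space A (\<gamma> s)"
    "\<And>s. \<bar>s - t\<bar> < d \<Longrightarrow>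
       \<bar>g (\<gamma> s) (parallel_transport A g (\<sigma> s) w) (velocity A UNIV \<gamma> s) - g (\<gamma> t) w (velocity A UNIV \<gamma> t)\<bar>
         \<le> \<epsilon> * \<bar>s - t\<bar>"
proof -
  obtain c where c: "c \<in> A" "\<gamma> t \<in> fst c" by (rule chart_exists)
  interpret mf: metric_field "snd c ` fst c" "metric_coord A g c" by (rule metric_field_coord[OF c(1)])
  let ?p = "\<gamma> t" and ?P = "snd c (\<gamma> t)" and ?\<Gamma> = "christoffel A g c" and ?y = "velocity A UNIV \<gamma>"
  let ?W = "\<lambda>s. parallel_transport A g (\<sigma> s) w"
  have P: "?P \<in> snd c ` fst c" using c by blast
  have C1: "C1_curve A UNIV \<gamma>" and T: "\<And>t. ?y t \<in> tangent_space A (\<gamma> t)"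
    using \<gamma> by (auto simp: geodesic_def parallel_along_def)
  define l where "l = tnorm g ?p (?y t)"
  have l0: "0 \<le> l" unfolding l_def by (rule tnorm_nonneg[OF T])
  have dist: "rdist A g ?p (\<gamma> s) \<le> \<bar>s - t\<bar> * l" for s
    unfolding l_def by (rule rdist_le_geodesic[OF \<gamma>])
  have linP: "linear (\<lambda>u. ?\<Gamma> ?P u (w c))"
    using mf.chris_bilinear[OF P] by (simp add: bilinear_def christoffel_eq_chris)
  \<comment> \<open>The remainder of the first-order expansion; its derivative at \<open>t\<close> is \<open>0\<close>.\<close>
  define R where "R s = ?W s c - w c + ?\<Gamma> ?P (snd c (\<gamma> s) - ?P) (w c)" for s
  have R: "\<exists>d>0. \<forall>s. \<bar>s - t\<bar> < d \<longrightarrow> ?W s \<in> tangent_space A (\<gamma> s) \<and> norm (R s) \<le> e * \<bar>s - t\<bar>" if e: "e > 0" for e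
  proof -
    \<comment> \<open>The speed \<open>l\<close> may be \<open>0\<close>, hence the summand \<open>1\<close>.\<close>
    have e': "e / (l + 1) > 0" using e l0 by simp
    obtain \<delta> where \<delta>: "\<delta> > 0" "\<And>\<sigma>. geodesic A g UNIV \<sigma> \<Longrightarrow> \<sigma> 0 = ?p \<Longrightarrow> tnorm g ?p (velocity A UNIV \<sigma> 0) < \<delta> \<Longrightarrow>
       parallel_transport A g \<sigma> w \<in> tangent_space A (\<sigma> 1) \<and>
       norm (parallel_transport A g \<sigma> w c - w c + ?\<Gamma> ?P (snd c (\<sigma> 1) - ?P) (w c))
         \<le> e / (l + 1) * tnorm g ?p (velocity A UNIV \<sigma> 0)"
      using infinitesimal_transport[OF c w e'] by blast
    show ?thesis
    proof (intro exI[of _ "\<delta> / (l + 1)"] conjI allI impI)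
      show "0 < \<delta> / (l + 1)" using \<delta> l0 by simp
      fix s assume s: "\<bar>s - t\<bar> < \<delta> / (l + 1)"
      have d1: "rdist A g ?p (\<gamma> s) \<le> \<bar>s - t\<bar> * (l + 1)"
        using dist[of s] by (simp add: algebra_simps)
      also have "\<dots> < \<delta>" using s l0 by (simp add: field_simps)
      finally have "tnorm g ?p (velocity A UNIV (\<sigma> s) 0) < \<delta>" by (simp add: \<sigma>(4))
      from \<delta>(2)[OF \<sigma>(1,2) this]
      have *: "?W s \<in> tangent_space A (\<gamma> s)" "norm (R s) \<le> e / (l + 1) * rdist A g ?p (\<gamma> s)"
        by (simp_all add: \<sigma> R_def)
      show "?W s \<in> tangent_space A (\<gamma> s)" by (rule *)
      note *(2)
      also have "e / (l + 1) * rdist A g ?p (\<gamma> s) \<le> e / (l + 1) * (\<bar>s - t\<bar> * (l + 1))"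
        using d1 e' by (intro mult_left_mono) auto
      also have "\<dots> = e * \<bar>s - t\<bar>" using l0 by simp
      finally show "norm (R s) \<le> e * \<bar>s - t\<bar>" .
    qed
  qed
  have R0: "R t = 0" using R[of 1] by (auto dest!: spec[of _ t])
  have R': "(R has_vector_derivative 0) (at t)"
    unfolding has_vector_derivative_def has_derivative_at_alt
    using R R0 by (auto intro!: bounded_linear_zero) (metis real_norm_def)
  have W: "?W s c = R s + w c - ?\<Gamma> ?P (snd c (\<gamma> s) - ?P) (w c)" for s by (simp add: R_def)
  have X': "((snd c \<circ> \<gamma>) has_vector_derivative ?y t c) (at t)"
    using C1_curve_has_velocity[OF C1 UNIV_I c] .
  then have "((\<lambda>s. snd c (\<gamma> s) - ?P) has_vector_derivative ?y t c) (at t)"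
    by (auto simp: o_def intro!: derivative_eq_intros)
  then have "((\<lambda>s. ?\<Gamma> ?P (snd c (\<gamma> s) - ?P) (w c)) has_vector_derivative ?\<Gamma> ?P (?y t c) (w c)) (at t)"
    by (rule bounded_linear.has_vector_derivative[OF linP[unfolded linear_conv_bounded_linear]])
  then have "((\<lambda>s. ?W s c) has_vector_derivative - ?\<Gamma> ?P (?y t c) (w c)) (at t)"
    unfolding W by (auto intro!: derivative_eq_intros R')
  moreover have W0: "?W t c = w c" using W[of t] R0 linear_0[OF linP] by simp
  ultimately have W': "((\<lambda>s. ?W s c) has_vector_derivative - ?\<Gamma> ?P (?y t c) (?W t c)) (at t)" by simp
  have y': "((\<lambda>s. ?y s c) has_vector_derivative - ?\<Gamma> ?P (?y t c) (?y t c)) (at t)"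
    using \<gamma> c by (simp add: geodesic_def parallel_along_def)
  have D: "((\<lambda>s. metric_coord A g c ((snd c \<circ> \<gamma>) s) (?W s c) (?y s c)) has_vector_derivative 0) (at t)"
    by (rule mf.parallel_product_deriv[OF _ X']) (use P W' y' in \<open>auto simp: christoffel_eq_chris\<close>)
  let ?h = "\<lambda>s. metric_coord A g c (snd c (\<gamma> s)) (?W s c) (?y s c)"
  have ht: "?h t = g ?p w (?y t)"
    using metric_coord_eq[OF c w T] W0 by simp
  obtain d1 where d1: "d1 > 0" "\<And>s. \<bar>s - t\<bar> < d1 \<Longrightarrow> \<bar>?h s - ?h t\<bar> \<le> \<epsilon> * \<bar>s - t\<bar>"
    using D \<epsilon> unfolding has_vector_derivative_def has_derivative_at_alt by auto
  obtain d2 where d2: "d2 > 0" "\<And>s. \<bar>s - t\<bar> < d2 \<Longrightarrow> ?W s \<in> tangent_space A (\<gamma> s)"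
    using R[of 1] by auto
  have "\<forall>\<^sub>F s in at t. \<gamma> s \<in> fst c"
    using eventually_in_chart[of UNIV \<gamma> t c] C1 c by (simp add: C1_curve_def)
  then obtain d3 where d3: "d3 > 0" "\<And>s. \<bar>s - t\<bar> < d3 \<Longrightarrow> \<gamma> s \<in> fst c"
    using c unfolding eventually_at by (metis UNIV_I dist_real_def)
  show thesis
  proof (rule that[of "min d1 (min d2 d3)"])
    show "0 < min d1 (min d2 d3)" using d1 d2 d3 by simp
    fix s assume s: "\<bar>s - t\<bar> < min d1 (min d2 d3)"
    then show WT: "?W s \<in> tangent_space A (\<gamma> s)" using d2 by simp
    have "?h s = g (\<gamma> s) (?W s) (?y s)"
      using metric_coord_eq[OF c(1) d3(2) WT T] s by simp
    then show "\<bar>g (\<gamma> s) (?W s) (?y s) - g ?p w (?y t)\<bar> \<le> \<epsilon> * \<bar>s - t\<bar>"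
      using d1(2)[of s] s ht by simp
  qed
qed

text \<open>The slope at \<open>s\<close> is compared with the product of \<open>\<gamma>' s\<close> and the gradient at \<open>t\<close> transported
  along a minimising geodesic. The Lipschitz hypothesis and the Cauchy-Schwarz inequality bound
  the difference, and the transported product is stationary.\<close>

lemma local_slope_variation:
  assumes lg: "logarithmic_map A g lg" and f: "C1_function A f" and L: "L > 0" "lipschitz_gradient A g f L"
    and \<gamma>: "geodesic A g UNIV \<gamma>" and \<epsilon>: "\<epsilon> > 0"
  obtains d where "d > 0" "\<And>s. \<bar>s - t\<bar> < d \<Longrightarrow>
    \<bar>g (\<gamma> s) (grad A g f (\<gamma> s)) (velocity A UNIV \<gamma> s) - g (\<gamma> t) (grad A g f (\<gamma> t)) (velocity A UNIV \<gamma> t)\<bar>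
      \<le> (L * (tnorm g (\<gamma> t) (velocity A UNIV \<gamma> t))\<^sup>2 + \<epsilon>) * \<bar>s - t\<bar>"
proof -
  let ?y = "velocity A UNIV \<gamma>" and ?G = "\<lambda>s. grad A g f (\<gamma> s)"
  have T: "\<And>s. ?y s \<in> tangent_space A (\<gamma> s)" using \<gamma> by (auto simp: geodesic_def parallel_along_def)
  define l where "l = tnorm g (\<gamma> t) (?y t)"
  have l0: "0 \<le> l" unfolding l_def by (rule tnorm_nonneg[OF T])
  have "\<forall>s. \<exists>\<sigma>. geodesic A g UNIV \<sigma> \<and> \<sigma> 0 = \<gamma> t \<and> \<sigma> 1 = \<gamma> s \<and>
      tnorm g (\<gamma> t) (velocity A UNIV \<sigma> 0) = rdist A g (\<gamma> t) (\<gamma> s) \<and> minimising_geodesic A g (\<gamma> t) (\<gamma> s) \<sigma>"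
    using minimising_geodesic_exists[OF lg] by metis
  then obtain \<sigma> where \<sigma>: "\<And>s. geodesic A g UNIV (\<sigma> s)" "\<And>s. \<sigma> s 0 = \<gamma> t" "\<And>s. \<sigma> s 1 = \<gamma> s"
      "\<And>s. tnorm g (\<gamma> t) (velocity A UNIV (\<sigma> s) 0) = rdist A g (\<gamma> t) (\<gamma> s)"
    and min: "\<And>s. minimising_geodesic A g (\<gamma> t) (\<gamma> s) (\<sigma> s)"
    by metis
  let ?W = "\<lambda>s. parallel_transport A g (\<sigma> s) (?G t)"
  obtain d where d: "d > 0" and WT: "\<And>s. \<bar>s - t\<bar> < d \<Longrightarrow> ?W s \<in> tangent_space A (\<gamma> s)"
    and near: "\<And>s. \<bar>s - t\<bar> < d \<Longrightarrow> \<bar>g (\<gamma> s) (?W s) (?y s) - g (\<gamma> t) (?G t) (?y t)\<bar> \<le> \<epsilon> * \<bar>s - t\<bar>"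
    using transported_product_stationary[OF gradient(1)[OF f] \<gamma> \<sigma> \<epsilon>] by metis
  show thesis
  proof (rule that[OF d])
    fix s assume s: "\<bar>s - t\<bar> < d"
    let ?E = "tadd (?W s) (tscale (-1) (?G s))"
    note GT = gradient(1)[OF f, of "\<gamma> s"]
    have E: "?E \<in> tangent_space A (\<gamma> s)" by (intro tadd_mem tscale_mem WT[OF s] GT)
    have "g (\<gamma> s) (?W s) (?y s) - g (\<gamma> s) (?G s) (?y s) = g (\<gamma> s) ?E (?y s)"
      by (simp add: metric_add[OF WT[OF s] tscale_mem[OF GT] T] metric_scale[OF GT T])
    then have "\<bar>g (\<gamma> s) (?W s) (?y s) - g (\<gamma> s) (?G s) (?y s)\<bar> \<le> tnorm g (\<gamma> s) ?E * tnorm g (\<gamma> s) (?y s)"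
      using metric_cauchy_schwarz[OF E T] by simp
    also have "tnorm g (\<gamma> s) (?y s) = l"
      unfolding l_def by (rule geodesic_speed_constant[OF \<gamma>]) auto
    also have "tnorm g (\<gamma> s) ?E * l \<le> (L * (\<bar>s - t\<bar> * l)) * l"
    proof (rule mult_right_mono[OF _ l0])
      have "tnorm g (\<gamma> s) ?E \<le> L * rdist A g (\<gamma> t) (\<gamma> s)"
        using L(2) min unfolding lipschitz_gradient_def by blast
      also have "\<dots> \<le> L * (\<bar>s - t\<bar> * l)"
        unfolding l_def using rdist_le_geodesic[OF \<gamma>] L by (intro mult_left_mono) auto
      finally show "tnorm g (\<gamma> s) ?E \<le> L * (\<bar>s - t\<bar> * l)" .
    qed
    also have "\<dots> = L * l\<^sup>2 * \<bar>s - t\<bar>" by (simp add: power2_eq_square)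
    finally have "\<bar>g (\<gamma> s) (?W s) (?y s) - g (\<gamma> s) (?G s) (?y s)\<bar> \<le> L * l\<^sup>2 * \<bar>s - t\<bar>" .
    with near[OF s] show "\<bar>g (\<gamma> s) (?G s) (?y s) - g (\<gamma> t) (?G t) (?y t)\<bar> \<le> (L * (tnorm g (\<gamma> t) (?y t))\<^sup>2 + \<epsilon>) * \<bar>s - t\<bar>"
      unfolding l_def[symmetric] distrib_right by linarith
  qed
qed

text \<open>With \<open>K + \<epsilon>\<close> in place of the rate \<open>K\<close>, the bound is additive over adjacent intervals and
  holds on all sufficiently small intervals around any given time, so bisection extends it to
  every interval.\<close>

lemma slope_variation:
  assumes lg: "logarithmic_map A g lg" and f: "C1_function A f" and L: "L > 0" "lipschitz_gradient A g f L"
    and \<gamma>: "geodesic A g UNIV \<gamma>" and ab: "a \<le> b"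
  defines "h \<equiv> \<lambda>t. g (\<gamma> t) (grad A g f (\<gamma> t)) (velocity A UNIV \<gamma> t)"
  shows "\<bar>h b - h a\<bar> \<le> L * (tnorm g (\<gamma> 0) (velocity A UNIV \<gamma> 0))\<^sup>2 * (b - a)"
proof -
  define K where "K = L * (tnorm g (\<gamma> 0) (velocity A UNIV \<gamma> 0))\<^sup>2"
  have K: "L * (tnorm g (\<gamma> t) (velocity A UNIV \<gamma> t))\<^sup>2 = K" for t
    unfolding K_def using geodesic_speed_constant[OF \<gamma>, of t 0] by simp
  have "\<bar>h b - h a\<bar> \<le> (K + \<epsilon>) * (b - a)" if \<epsilon>: "\<epsilon> > 0" for \<epsilon>
    using ab
  proof (induction rule: Bolzano)
    case (trans a b c)
    then show ?case by (simp add: algebra_simps)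
  next
    case (local t)
    obtain d where d: "d > 0" "\<And>s. \<bar>s - t\<bar> < d \<Longrightarrow> \<bar>h s - h t\<bar> \<le> (K + \<epsilon>) * \<bar>s - t\<bar>"
      using local_slope_variation[OF lg f L \<gamma> \<epsilon>, of t] unfolding h_def K by metis
    show ?case
    proof (intro exI[of _ d] conjI d(1) allI impI)
      fix a b assume s: "a \<le> t \<and> t \<le> b \<and> b - a < d"
      have "\<bar>h b - h t\<bar> \<le> (K + \<epsilon>) * (b - t)" "\<bar>h a - h t\<bar> \<le> (K + \<epsilon>) * (t - a)"
        using d(2)[of b] d(2)[of a] s by auto
      then show "\<bar>h b - h a\<bar> \<le> (K + \<epsilon>) * (b - a)" by (simp add: algebra_simps)
    qed
  qed
  note bound = this
  show ?thesis
  proof (rule field_le_epsilon)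
    fix e :: real assume e: "e > 0"
    \<comment> \<open>The summand \<open>1\<close> covers the case \<open>a = b\<close>.\<close>
    have "\<bar>h b - h a\<bar> \<le> (K + e / (b - a + 1)) * (b - a)" using e ab by (intro bound) simp
    also have "\<dots> = K * (b - a) + e * ((b - a) / (b - a + 1))" by (simp add: algebra_simps)
    also have "e * ((b - a) / (b - a + 1)) \<le> e * 1"
      using e ab by (intro mult_left_mono) (auto simp: divide_le_eq)
    finally show "\<bar>h b - h a\<bar> \<le> L * (tnorm g (\<gamma> 0) (velocity A UNIV \<gamma> 0))\<^sup>2 * (b - a) + e" by (simp add: K_def)
  qed
qed

text \<open>The slope of \<open>f\<close> along the geodesic grows at most at the rate \<open>L \<parallel>v\<parallel>\<^sup>2\<close>; integrating this
  over the unit interval yields the quadratic term.\<close>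

lemma descent:
  assumes lg: "logarithmic_map A g lg" and f: "C1_function A f" and L: "L > 0" "lipschitz_gradient A g f L"
    and v: "v \<in> tangent_space A x"
  shows "f (exp_map A g x v) \<le> f x + g x (grad A g f x) v + L / 2 * (tnorm g x v)\<^sup>2"
proof -
  obtain \<gamma> where \<gamma>: "geodesic A g UNIV \<gamma>" "\<gamma> 0 = x" "velocity A UNIV \<gamma> 0 = v" "\<gamma> 1 = exp_map A g x v"
    using exp_map_geodesic[OF v] by metis
  define h where "h t = g (\<gamma> t) (grad A g f (\<gamma> t)) (velocity A UNIV \<gamma> t)" for t
  let ?K = "L * (tnorm g x v)\<^sup>2"
  have h: "h t \<le> h 0 + ?K * t" if "0 \<le> t" for t
    using slope_variation[OF lg f L \<gamma>(1) that] \<gamma> by (simp add: h_def)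
  define \<phi> where "\<phi> t = f (\<gamma> t) - t * h 0 - ?K * t\<^sup>2 / 2" for t
  have "\<phi> 1 \<le> \<phi> 0"
  proof (rule DERIV_nonpos_imp_nonincreasing[of 0 1 \<phi>])
    fix t :: real assume t: "0 \<le> t" "t \<le> 1"
    have "(\<phi> has_real_derivative h t - h 0 - ?K * t) (at t)"
      using slope_along_geodesic[OF f \<gamma>(1), of t] by (auto intro!: derivative_eq_intros simp: h_def \<phi>_def[abs_def])
    then show "\<exists>y. (\<phi> has_real_derivative y) (at t) \<and> y \<le> 0" using h[OF t(1)] by auto
  qed simp
  then show ?thesis using \<gamma> by (simp add: h_def \<phi>_def)
qed

end

section \<open>The accelerated iteration\<close>

lemma contraction_with_errors:
  fixes F e :: "nat \<Rightarrow> real"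
  assumes q: "0 \<le> q" "q \<le> 1" and e: "\<And>n. 0 \<le> e n"
    and step: "\<And>n. F (Suc n) \<le> q * (F n + e n)"
  shows "F n \<le> q ^ n * F 0 + (\<Sum>k<n. e k)"
proof (induction n)
  case (Suc n)
  have "F (Suc n) \<le> q * (F n + e n)" by (rule step)
  also have "\<dots> \<le> q * (q ^ n * F 0 + ((\<Sum>k<n. e k) + e n))"
    using Suc q by (intro mult_left_mono) auto
  also have "\<dots> = q ^ Suc n * F 0 + q * (\<Sum>k<Suc n. e k)" by (simp add: distrib_left)
  also have "\<dots> \<le> q ^ Suc n * F 0 + (\<Sum>k<Suc n. e k)"
    using q e by (intro add_left_mono mult_left_le_one_le sum_nonneg) auto
  finally show ?case .
qed simp

context complete_rmanifold
begin

text \<open>The extrapolation has length at most \<open>\<mu> d(x\<^sub>n, x\<^sub>n\<^sub>-\<^sub>1)\<close> and, owing to the switch, a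
  nonpositive linear term, so that \<open>descent\<close> leaves only the quadratic term as an error. In the
  gradient step \<open>descent\<close> yields a decrease proportional to the squared gradient, to which the
  Polyak-Lojasiewicz inequality applies.\<close>

lemma riag_r_one_step:
  assumes lg: "logarithmic_map A g lg" and f: "C1_function A f" and L: "L > 0" "lipschitz_gradient A g f L"
    and pl: "(tnorm g (w n) (grad A g f (w n)))\<^sup>2 \<ge> 2 * m * (f (w n) - f_star)"
    and fs: "f (w n) \<ge> f_star" and m: "m > 0" and \<mu>: "0 < \<mu>"
    and alg: "riag_r A g lg f \<eta> \<epsilon> \<mu> x w G step" and n: "n \<ge> 1"
    and \<alpha>: "\<alpha> \<le> step n * (1 - L * step n / 2)" "0 < \<alpha>" "\<alpha> * m < 1"
  shows "f (x (n + 1)) - f_star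
    \<le> (1 - \<alpha> * m) * (f (x n) - f_star + L * \<mu>\<^sup>2 / 2 * (rdist A g (x n) (x (n - 1)))\<^sup>2)"
proof -
  let ?r = "rdist A g (x n) (x (n - 1))"
  define \<mu>b where "\<mu>b = (if x n \<noteq> x (n - 1) then min \<mu> (\<mu> * ?r) else \<mu>)"
  define d where "d = tscale (-1) (lg (x n) (x (n - 1)))"
  define \<mu>t where "\<mu>t = (if g (x n) (grad A g f (x n)) d > 0 then 0 else \<mu>b)"
  have w: "w n = exp_map A g (x n) (tscale \<mu>t d)"
    and x: "x (n + 1) = exp_map A g (w n) (tscale (- step n) (grad A g f (w n)))"
    using alg n unfolding riag_r_def Let_def \<mu>t_def \<mu>b_def d_def by blast+
  have l: "lg (x n) (x (n - 1)) \<in> tangent_space A (x n)" "tnorm g (x n) (lg (x n) (x (n - 1))) = ?r"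
    using lg by (auto simp: logarithmic_map_def)
  have d: "d \<in> tangent_space A (x n)" "tnorm g (x n) d = ?r"
    using l by (simp_all add: d_def tscale_mem tnorm_scale)
  have r: "0 \<le> ?r" using tnorm_nonneg[OF l(1)] l(2) by simp
  have \<mu>t: "0 \<le> \<mu>t" "\<mu>t \<le> \<mu>" using \<mu> r by (auto simp: \<mu>t_def \<mu>b_def)
  note Gx = gradient(1)[OF f, of "x n"] and Gw = gradient(1)[OF f, of "w n"]
  have "f (w n) \<le> f (x n) + \<mu>t * g (x n) (grad A g f (x n)) d + L / 2 * (\<mu>t * ?r)\<^sup>2"
    using descent[OF lg f L tscale_mem[OF d(1)], of \<mu>t] \<mu>t
    by (simp add: w metric_scale_right[OF Gx d(1)] tnorm_scale[OF d(1)] d(2))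
  moreover have "\<mu>t * g (x n) (grad A g f (x n)) d \<le> 0"
    using \<mu>t(1) by (cases "g (x n) (grad A g f (x n)) d > 0") (auto simp: \<mu>t_def mult_nonneg_nonpos)
  moreover have "L / 2 * (\<mu>t * ?r)\<^sup>2 \<le> L / 2 * (\<mu> * ?r)\<^sup>2"
    using L \<mu>t r by (intro mult_left_mono power_mono mult_right_mono) auto
  ultimately have fw: "f (w n) \<le> f (x n) + L * \<mu>\<^sup>2 / 2 * ?r\<^sup>2"
    by (simp add: power_mult_distrib)
  let ?s = "step n" and ?N = "(tnorm g (w n) (grad A g f (w n)))\<^sup>2"
  have "f (x (n + 1)) \<le> f (w n) - ?s * ?N + L / 2 * (?s\<^sup>2 * ?N)"
    using descent[OF lg f L tscale_mem[OF Gw], of "- ?s"]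
    unfolding x by (simp add: metric_scale_right[OF Gw Gw] tnorm_scale[OF Gw] tnorm_square[OF Gw] power_mult_distrib)
  also have "\<dots> = f (w n) - ?s * (1 - L * ?s / 2) * ?N" by (simp add: field_simps power2_eq_square)
  also have "\<dots> \<le> f (w n) - \<alpha> * ?N"
    using \<alpha>(1) by (intro diff_left_mono mult_right_mono) auto
  also have "\<dots> \<le> f (w n) - \<alpha> * (2 * m * (f (w n) - f_star))"
    using pl \<alpha>(2) by (intro diff_left_mono mult_left_mono) auto
  \<comment> \<open>A factor \<open>2\<close> is given away, because \<open>1 - 2 \<alpha> m\<close> may be negative.\<close>
  also have "\<dots> \<le> f (w n) - \<alpha> * (m * (f (w n) - f_star))"
    using fs m \<alpha>(2) by (intro diff_left_mono mult_left_mono) (auto intro: mult_right_mono)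
  finally have "f (x (n + 1)) - f_star \<le> (1 - \<alpha> * m) * (f (w n) - f_star)"
    by (simp add: algebra_simps)
  also have "\<dots> \<le> (1 - \<alpha> * m) * (f (x n) - f_star + L * \<mu>\<^sup>2 / 2 * ?r\<^sup>2)"
    using fw \<alpha>(3) by (intro mult_left_mono) auto
  finally show ?thesis .
qed

end

lemma riag_r_step_bounds:
  assumes alg: "riag_r A g lg f \<eta> \<epsilon> \<mu> x w G step" and pos: "\<eta> > 0" "\<epsilon> > 0" and n: "n \<ge> 1"
  shows "0 < step n" "step n \<le> \<eta> / \<epsilon>"
proof -
  have G0: "G 0 = 0" and GS: "\<And>n. n \<ge> 1 \<Longrightarrow> G n = G (n - 1) + (tnorm g (w n) (grad A g f (w n)))\<^sup>2"
    and s: "step n = \<eta> / (sqrt (G n) + \<epsilon>)"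
    using alg n unfolding riag_r_def Let_def by blast+
  have "0 \<le> G k" for k
  proof (induction k)
    case (Suc k)
    then show ?case using GS[of "Suc k"] by simp
  qed (simp add: G0)
  then have "0 \<le> sqrt (G n)" by simp
  then show "0 < step n" "step n \<le> \<eta> / \<epsilon>"
    using pos unfolding s by (auto intro!: divide_pos_pos divide_left_mono mult_pos_pos add_nonneg_pos)
qed

theorem proposition3p7:
  fixes A :: "('a::{t2_space, second_countable_topology}, 'e::euclidean_space) chart set"
    and g :: "('a, 'e) metric"
    and lg :: "'a \<Rightarrow> 'a \<Rightarrow> ('a, 'e) tangent"
    and f :: "'a \<Rightarrow> real"
    and L f_star m \<eta> \<epsilon> \<mu> \<alpha> D :: real
    and x w :: "nat \<Rightarrow> 'a"
    and G step :: "nat \<Rightarrow> real"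
  assumes "riemannian_manifold A g"
    and "connected (UNIV :: 'a set)"
    and "geodesically_complete A g"
    and "logarithmic_map A g lg"
    and "C1_function A f"
    and "L > 0" and "lipschitz_gradient A g f L"
    and "\<And>p. f p \<ge> f_star"
    and "m > 0" and "\<And>p. (tnorm g p (grad A g f p))\<^sup>2 \<ge> 2 * m * (f p - f_star)"
    and "\<eta> > 0" and "\<epsilon> > 0" and "0 < \<mu>" and "\<mu> < 1"
    and "riag_r A g lg f \<eta> \<epsilon> \<mu> x w G step"
    and "\<alpha> = (INF n\<in>{1..}. step n * (1 - L * step n / 2))" and "\<alpha> > 0"
    and "summable (\<lambda>n. (rdist A g (x (n + 1)) (x n))\<^sup>2)"
    and "D = (\<Sum>n. (rdist A g (x (n + 1)) (x n))\<^sup>2)"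
    and "\<alpha> * m < 1"
  shows "\<forall>n\<ge>1. f (x n) - f_star
           \<le> (1 - \<alpha> * m) ^ (n - 1) * (f (x 1) - f_star) + L * \<mu>\<^sup>2 * (\<alpha> * L + 1 / 2) * D"
proof (intro allI impI)
  fix n :: nat assume n: "n \<ge> 1"
  interpret complete_rmanifold A g by unfold_locales fact+
  let ?r = "\<lambda>n. rdist A g (x (n + 1)) (x n)"
  note step = riag_r_step_bounds[OF \<open>riag_r A g lg f \<eta> \<epsilon> \<mu> x w G step\<close> \<open>\<eta> > 0\<close> \<open>\<epsilon> > 0\<close>]
  \<comment> \<open>The infimum is a lower bound only because the step sizes are bounded by \<open>\<eta> / \<epsilon>\<close>.\<close>
  have "bdd_below ((\<lambda>n. step n * (1 - L * step n / 2)) ` {1..})"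
  proof (rule bdd_belowI2)
    fix k :: nat assume "k \<in> {1..}"
    then have s: "0 < step k" "step k \<le> \<eta> / \<epsilon>" using step[of k] by auto
    have "L / 2 * (step k)\<^sup>2 \<le> L / 2 * (\<eta> / \<epsilon>)\<^sup>2"
      using s \<open>L > 0\<close> by (intro mult_left_mono power_mono) auto
    then show "- (L / 2 * (\<eta> / \<epsilon>)\<^sup>2) \<le> step k * (1 - L * step k / 2)"
      using s(1) by (simp add: algebra_simps power2_eq_square)
  qed
  then have \<alpha>: "\<alpha> \<le> step k * (1 - L * step k / 2)" if "k \<ge> 1" for k
    unfolding \<open>\<alpha> = _\<close> using that by (intro cINF_lower) auto
  have "f (x (Suc (Suc k))) - f_star
      \<le> (1 - \<alpha> * m) * (f (x (Suc k)) - f_star + L * \<mu>\<^sup>2 / 2 * (?r k)\<^sup>2)" for k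
    using riag_r_one_step[where n="Suc k" and m=m and f_star=f_star and \<alpha>=\<alpha>, OF assms(4-7) assms(10) assms(8,9,13,15) _ \<alpha>] assms(17,20)
    by simp
  then have "f (x (Suc (n - 1))) - f_star
      \<le> (1 - \<alpha> * m) ^ (n - 1) * (f (x (Suc 0)) - f_star) + (\<Sum>k<n - 1. L * \<mu>\<^sup>2 / 2 * (?r k)\<^sup>2)"
    using \<open>\<alpha> * m < 1\<close> \<open>\<alpha> > 0\<close> \<open>m > 0\<close> \<open>L > 0\<close>
    by (intro contraction_with_errors[where F="\<lambda>k. f (x (Suc k)) - f_star"]) auto
  then have "f (x n) - f_star
      \<le> (1 - \<alpha> * m) ^ (n - 1) * (f (x 1) - f_star) + L * \<mu>\<^sup>2 / 2 * (\<Sum>k<n - 1. (?r k)\<^sup>2)"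
    using n by (simp add: sum_distrib_left)
  also have "L * \<mu>\<^sup>2 / 2 * (\<Sum>k<n - 1. (?r k)\<^sup>2) \<le> L * \<mu>\<^sup>2 / 2 * D"
    unfolding \<open>D = _\<close> using \<open>L > 0\<close> by (intro mult_left_mono sum_le_suminf assms(18)) auto
  also have "\<dots> \<le> L * \<mu>\<^sup>2 * (\<alpha> * L + 1 / 2) * D"
  proof -
    have "0 \<le> D" unfolding \<open>D = _\<close> by (intro suminf_nonneg assms(18)) simp
    then have "0 \<le> L * \<mu>\<^sup>2 * (\<alpha> * L) * D" using \<open>L > 0\<close> \<open>\<alpha> > 0\<close> by simp
    then show ?thesis by (simp add: algebra_simps)
  qed
  finally show "f (x n) - f_star
      \<le> (1 - \<alpha> * m) ^ (n - 1) * (f (x 1) - f_star) + L * \<mu>\<^sup>2 * (\<alpha> * L + 1 / 2) * D"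
    by simp
qed

end
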